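(* Suppose $\Lambda$ is a finitely aligned $k$-graph. Then the following are equivalent: (1) $\Lambda$ is aperiodic; (2) $\Lambda$ has no local periodicity; (3) $\Lambda$ satisfies condition (A): for each $v\in\Lambda^0$ there exists $x\in v(\partial\Lambda)$ such that for all $m,n\in\mathbb{N}^k$ with $m,n\le d(x)$, $\sigma^m(x)=\sigma^n(x)$ implies $m=n$; (4) $\Lambda$ satisfies condition (B): for each $v\in\Lambda^0$ there exists $x\in v\Lambda^{\le\infty}$ such that for all $\lambda,\mu\in\Lambda$ with $s(\lambda)=s(\mu)=v$, $\lambda\neq\mu$ implies $\lambda x\neq\mu x$.
   Context: Conventions. $\mathbb{N}$ contains $0$, $k\ge 1$ is an integer, $\mathbb{N}^k$ and $(\mathbb{N}\cup\{\infty\})^k$ are ordered coordinatewise, $e_i$ is the $i$th generator of $\mathbb{N}^k$, and $m\vee n$, $m\wedge n$ denote the coordinatewise maximum and minimum. A $k$-graph $(\Lambda,d)$ is a countable small category $\Lambda$ (identified with its set of morphisms, called paths) with a functor $d:\Lambda\to\mathbb{N}^k$ satisfying the factorisation property: whenever $d(\lambda)=m+n$ there exist unique $\mu,\nu\in\Lambda$ with $d(\mu)=m$, $d(\nu)=n$ and $\lambda=\mu\nu$. Write $\Lambda^n=\{\lambda\in\Lambda: d(\lambda)=n\}$. Objects are identified with their identity morphisms, which form $\Lambda^0$ (the vertices). $r(\lambda),s(\lambda)\in\Lambda^0$ are the unique vertices with $\lambda=r(\lambda)\lambda=\lambda s(\lambda)$; the product $\mu\nu$ is defined exactly when $s(\mu)=r(\nu)$.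 For $m\le n\le d(\lambda)$, $\lambda(m,n)$ is the unique path in $\Lambda^{n-m}$ with $\lambda=\lambda'\lambda(m,n)\lambda''$, $d(\lambda')=m$, $d(\lambda'')=d(\lambda)-n$. For $v\in\Lambda^0$ and $X\subseteq\Lambda$: $vX=\{\lambda\in X:r(\lambda)=v\}$. A $k$-graph morphism is a degree-preserving functor. For $\mu,\nu\in\Lambda$, $\operatorname{MCE}(\mu,\nu)=\{\lambda\in\Lambda: d(\lambda)=d(\mu)\vee d(\nu),\ \lambda(0,d(\mu))=\mu,\ \lambda(0,d(\nu))=\nu\}$. $\Lambda$ is finitely aligned if $\operatorname{MCE}(\mu,\nu)$ is finite for all $\mu,\nu\in\Lambda$. A set $E\subseteq v\Lambda$ is exhaustive if for every $\mu\in v\Lambda$ there is $\lambda\in E$ with $\operatorname{MCE}(\mu,\lambda)\neq\emptyset$; $v\operatorname{FE}(\Lambda)$ is the set of finite exhaustive subsets of $v\Lambda$. For $m\in(\mathbb{N}\cup\{\infty\})^k$, $\Omega_{k,m}$ is the $k$-graph with morphisms $(p,q)$, $p\le q\le m$, $p,q\in\mathbb{N}^k$, $r(p,q)=(p,p)$, $s(p,q)=(q,q)$, $d(p,q)=q-p$, $(p,q)(q,l)=(p,l)$; the vertex $(q,q)$ is written $q$. For a $k$-graph morphism $x:\Omega_{k,m}\to\Lambda$ put $r(x)=x(0)$, $d(x)=m$. For $n\in\mathbb{N}^k$, $n\le d(x)$, $\sigma^n(x):\Omega_{k,d(x)-n}\to\Lambda$ is $\sigma^n(x)(p,q)=x(n+p,n+q)$.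 For $\lambda\in\Lambda$ with $s(\lambda)=r(x)$, $\lambda x:\Omega_{k,d(x)+d(\lambda)}\to\Lambda$ is the unique morphism with $(\lambda x)(0,d(\lambda))=\lambda$ and $\sigma^{d(\lambda)}(\lambda x)=x$. $\partial\Lambda$ is the set of all $k$-graph morphisms $x:\Omega_{k,m}\to\Lambda$ ($m\in(\mathbb{N}\cup\{\infty\})^k$) such that for all $n\in\mathbb{N}^k$ with $n\le d(x)$ and all $E\in x(n)\operatorname{FE}(\Lambda)$ there exists $p\in\mathbb{N}^k$ with $p\le d(x)-n$ and $x(n,n+p)\in E$. $v(\partial\Lambda)=\{x\in\partial\Lambda:r(x)=v\}$. $\Lambda^{\le\infty}$ is the set of all $k$-graph morphisms $x:\Omega_{k,m}\to\Lambda$ ($m\in(\mathbb{N}\cup\{\infty\})^k$) for which there is $n_x\in\mathbb{N}^k$, $n_x\le m$, such that whenever $n\in\mathbb{N}^k$ satisfies $n_x\le n\le m$ and $n_i=m_i$, we have $x(n)\Lambda^{e_i}=\emptyset$. $v\Lambda^{\le\infty}=\{x\in\Lambda^{\le\infty}:r(x)=v\}$. $\Lambda$ is aperiodic if for every pair of distinct $\alpha,\beta\in\Lambda$ with $s(\alpha)=s(\beta)$ there exists $\tau\in s(\alpha)\Lambda$ such that $\operatorname{MCE}(\alpha\tau,\beta\tau)=\emptyset$. For distinct $m,n\in\mathbb{N}^k$ and $v\in\Lambda^0$, $\Lambda$ has local periodicity $m,n$ at $v$ if for every $x\in v(\partial\Lambda)$ we have $m\vee n\le d(x)$ and $\sigma^m(x)=\sigma^n(x)$.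 $\Lambda$ has no local periodicity if it does not have local periodicity $m,n$ at $v$ for any $v\in\Lambda^0$ and any distinct $m,n\in\mathbb{N}^k$. *)

theory Defs
  imports
    "HOL-Library.FuncSet"
    "HOL-Library.Countable_Set"
    "HOL-Library.Extended_Nat"
    "HOL-Library.Function_Algebras"
begin

text \<open>
  \<open>\<nat>\<^sup>k\<close> is the function type \<open>'k \<Rightarrow> nat\<close> with a finite index type \<open>'k\<close>, and
  \<open>(\<nat> \<union> {\<infinity>})\<^sup>k\<close> is \<open>'k \<Rightarrow> enat\<close>; since types are nonempty, \<open>k \<ge> 1\<close> is automatic.
  Order, \<open>sup\<close>, \<open>inf\<close>, \<open>0\<close>, \<open>+\<close> and \<open>-\<close> are the pointwise ones.
\<close>

abbreviation (input) ext :: "('k \<Rightarrow> nat) \<Rightarrow> 'k \<Rightarrow> enat" where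
  "ext n \<equiv> (\<lambda>i. enat (n i))"

definition gen :: "'k \<Rightarrow> 'k \<Rightarrow> nat" where
  "gen i = (\<lambda>j. if j = i then 1 else 0)"


section \<open>\<open>k\<close>-graphs\<close>

text \<open>
  A category is given by its set of morphisms, with objects identified with identity
  morphisms. The composition is a total function whose value is meaningful only on pairs
  \<open>\<mu>\<close>, \<open>\<nu>\<close> of paths with \<open>src \<mu> = rng \<nu>\<close>.
\<close>

record ('a, 'k) kgraph =
  paths :: "'a set"
  pcomp :: "'a \<Rightarrow> 'a \<Rightarrow> 'a" (infixl "\<cdot>\<index>" 70)
  rng :: "'a \<Rightarrow> 'a"
  src :: "'a \<Rightarrow> 'a"
  deg :: "'a \<Rightarrow> 'k \<Rightarrow> nat"

locale k_graph =
  fixes \<Lambda> :: "('a, 'k::finite) kgraph" (structure)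
  assumes countable_paths: "countable (paths \<Lambda>)"
    and rng_closed: "\<mu> \<in> paths \<Lambda> \<Longrightarrow> rng \<Lambda> \<mu> \<in> paths \<Lambda>"
    and src_closed: "\<mu> \<in> paths \<Lambda> \<Longrightarrow> src \<Lambda> \<mu> \<in> paths \<Lambda>"
    and rng_rng: "\<mu> \<in> paths \<Lambda> \<Longrightarrow> rng \<Lambda> (rng \<Lambda> \<mu>) = rng \<Lambda> \<mu>"
    and src_rng: "\<mu> \<in> paths \<Lambda> \<Longrightarrow> src \<Lambda> (rng \<Lambda> \<mu>) = rng \<Lambda> \<mu>"
    and rng_src: "\<mu> \<in> paths \<Lambda> \<Longrightarrow> rng \<Lambda> (src \<Lambda> \<mu>) = src \<Lambda> \<mu>"
    and src_src: "\<mu> \<in> paths \<Lambda> \<Longrightarrow> src \<Lambda> (src \<Lambda> \<mu>) = src \<Lambda> \<mu>"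
    and comp_closed: "\<lbrakk>\<mu> \<in> paths \<Lambda>; \<nu> \<in> paths \<Lambda>; src \<Lambda> \<mu> = rng \<Lambda> \<nu>\<rbrakk> \<Longrightarrow> \<mu> \<cdot> \<nu> \<in> paths \<Lambda>"
    and rng_comp: "\<lbrakk>\<mu> \<in> paths \<Lambda>; \<nu> \<in> paths \<Lambda>; src \<Lambda> \<mu> = rng \<Lambda> \<nu>\<rbrakk> \<Longrightarrow> rng \<Lambda> (\<mu> \<cdot> \<nu>) = rng \<Lambda> \<mu>"
    and src_comp: "\<lbrakk>\<mu> \<in> paths \<Lambda>; \<nu> \<in> paths \<Lambda>; src \<Lambda> \<mu> = rng \<Lambda> \<nu>\<rbrakk> \<Longrightarrow> src \<Lambda> (\<mu> \<cdot> \<nu>) = src \<Lambda> \<nu>"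
    and comp_assoc:
      "\<lbrakk>\<mu> \<in> paths \<Lambda>; \<nu> \<in> paths \<Lambda>; \<tau> \<in> paths \<Lambda>; src \<Lambda> \<mu> = rng \<Lambda> \<nu>; src \<Lambda> \<nu> = rng \<Lambda> \<tau>\<rbrakk>
        \<Longrightarrow> (\<mu> \<cdot> \<nu>) \<cdot> \<tau> = \<mu> \<cdot> (\<nu> \<cdot> \<tau>)"
    and comp_rng: "\<mu> \<in> paths \<Lambda> \<Longrightarrow> rng \<Lambda> \<mu> \<cdot> \<mu> = \<mu>"
    and comp_src: "\<mu> \<in> paths \<Lambda> \<Longrightarrow> \<mu> \<cdot> src \<Lambda> \<mu> = \<mu>"
    and deg_rng: "\<mu> \<in> paths \<Lambda> \<Longrightarrow> deg \<Lambda> (rng \<Lambda> \<mu>) = 0"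
    and deg_src: "\<mu> \<in> paths \<Lambda> \<Longrightarrow> deg \<Lambda> (src \<Lambda> \<mu>) = 0"
    and deg_comp:
      "\<lbrakk>\<mu> \<in> paths \<Lambda>; \<nu> \<in> paths \<Lambda>; src \<Lambda> \<mu> = rng \<Lambda> \<nu>\<rbrakk> \<Longrightarrow> deg \<Lambda> (\<mu> \<cdot> \<nu>) = deg \<Lambda> \<mu> + deg \<Lambda> \<nu>"
    and factorisation:
      "\<lbrakk>\<kappa> \<in> paths \<Lambda>; deg \<Lambda> \<kappa> = m + n\<rbrakk> \<Longrightarrow>
        \<exists>!(\<mu>, \<nu>). \<mu> \<in> paths \<Lambda> \<and> \<nu> \<in> paths \<Lambda> \<and> deg \<Lambda> \<mu> = m \<and> deg \<Lambda> \<nu> = n \<and>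
          src \<Lambda> \<mu> = rng \<Lambda> \<nu> \<and> \<kappa> = \<mu> \<cdot> \<nu>"

definition paths_deg :: "('a, 'k) kgraph \<Rightarrow> ('k \<Rightarrow> nat) \<Rightarrow> 'a set" where
  "paths_deg \<Lambda> n = {\<mu> \<in> paths \<Lambda>. deg \<Lambda> \<mu> = n}"

abbreviation verts :: "('a, 'k) kgraph \<Rightarrow> 'a set" where
  "verts \<Lambda> \<equiv> paths_deg \<Lambda> 0"

definition at_vertex :: "('a, 'k) kgraph \<Rightarrow> 'a \<Rightarrow> 'a set \<Rightarrow> 'a set" where
  "at_vertex \<Lambda> v X = {\<mu> \<in> X. rng \<Lambda> \<mu> = v}"

text \<open>\<open>segment \<Lambda> \<kappa> m n\<close> is \<open>\<kappa>(m,n)\<close>; it is meaningful only for \<open>m \<le> n \<le> deg \<Lambda> \<kappa>\<close>.\<close>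

definition segment :: "('a, 'k) kgraph \<Rightarrow> 'a \<Rightarrow> ('k \<Rightarrow> nat) \<Rightarrow> ('k \<Rightarrow> nat) \<Rightarrow> 'a" where
  "segment \<Lambda> \<kappa> m n = (THE \<mu>. \<mu> \<in> paths_deg \<Lambda> (n - m) \<and>
     (\<exists>\<kappa>' \<in> paths \<Lambda>. \<exists>\<kappa>'' \<in> paths \<Lambda>. deg \<Lambda> \<kappa>' = m \<and> deg \<Lambda> \<kappa>'' = deg \<Lambda> \<kappa> - n \<and>
        src \<Lambda> \<kappa>' = rng \<Lambda> \<mu> \<and> src \<Lambda> \<mu> = rng \<Lambda> \<kappa>'' \<and>
        \<kappa> = \<kappa>' \<cdot>\<^bsub>\<Lambda>\<^esub> \<mu> \<cdot>\<^bsub>\<Lambda>\<^esub> \<kappa>''))"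

definition MCE :: "('a, 'k) kgraph \<Rightarrow> 'a \<Rightarrow> 'a \<Rightarrow> 'a set" where
  "MCE \<Lambda> \<mu> \<nu> = {\<kappa> \<in> paths \<Lambda>. deg \<Lambda> \<kappa> = sup (deg \<Lambda> \<mu>) (deg \<Lambda> \<nu>) \<and>
     segment \<Lambda> \<kappa> 0 (deg \<Lambda> \<mu>) = \<mu> \<and> segment \<Lambda> \<kappa> 0 (deg \<Lambda> \<nu>) = \<nu>}"

definition finitely_aligned :: "('a, 'k) kgraph \<Rightarrow> bool" where
  "finitely_aligned \<Lambda> \<longleftrightarrow> (\<forall>\<mu> \<in> paths \<Lambda>. \<forall>\<nu> \<in> paths \<Lambda>. finite (MCE \<Lambda> \<mu> \<nu>))"

definition exhaustive :: "('a, 'k) kgraph \<Rightarrow> 'a \<Rightarrow> 'a set \<Rightarrow> bool" where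
  "exhaustive \<Lambda> v E \<longleftrightarrow> E \<subseteq> at_vertex \<Lambda> v (paths \<Lambda>) \<and>
     (\<forall>\<mu> \<in> at_vertex \<Lambda> v (paths \<Lambda>). \<exists>\<nu> \<in> E. MCE \<Lambda> \<mu> \<nu> \<noteq> {})"

definition FE :: "('a, 'k) kgraph \<Rightarrow> 'a \<Rightarrow> 'a set set" where
  "FE \<Lambda> v = {E. finite E \<and> exhaustive \<Lambda> v E}"

definition kgraph_morphism ::
  "('a, 'k) kgraph \<Rightarrow> ('b, 'k) kgraph \<Rightarrow> ('a \<Rightarrow> 'b) \<Rightarrow> bool" where
  "kgraph_morphism \<Gamma> \<Lambda> f \<longleftrightarrow>
     (\<forall>\<mu> \<in> paths \<Gamma>. f \<mu> \<in> paths \<Lambda> \<and> deg \<Lambda> (f \<mu>) = deg \<Gamma> \<mu> \<and>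
        rng \<Lambda> (f \<mu>) = f (rng \<Gamma> \<mu>) \<and> src \<Lambda> (f \<mu>) = f (src \<Gamma> \<mu>)) \<and>
     (\<forall>\<mu> \<in> paths \<Gamma>. \<forall>\<nu> \<in> paths \<Gamma>. src \<Gamma> \<mu> = rng \<Gamma> \<nu> \<longrightarrow>
        f (\<mu> \<cdot>\<^bsub>\<Gamma>\<^esub> \<nu>) = f \<mu> \<cdot>\<^bsub>\<Lambda>\<^esub> f \<nu>)"


section \<open>Morphisms from \<open>\<Omega>\<^sub>k\<^sub>,\<^sub>m\<close>\<close>

definition Omega :: "('k \<Rightarrow> enat) \<Rightarrow> (('k \<Rightarrow> nat) \<times> ('k \<Rightarrow> nat), 'k) kgraph" where
  "Omega m = \<lparr>
     paths = {(p, q). p \<le> q \<and> ext q \<le> m},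
     pcomp = (\<lambda>\<mu> \<nu>. (fst \<mu>, snd \<nu>)),
     rng = (\<lambda>(p, q). (p, p)),
     src = (\<lambda>(p, q). (q, q)),
     deg = (\<lambda>(p, q). q - p)\<rparr>"

lemma k_graph_Omega: "k_graph (Omega (m::'k::finite \<Rightarrow> enat))"
proof
  show "countable (paths (Omega m))" by simp
next
  fix \<kappa> and a b :: "'k \<Rightarrow> nat" assume k: "\<kappa> \<in> paths (Omega m)" "deg (Omega m) \<kappa> = a + b"
  obtain p q where pq: "\<kappa> = (p,q)" by force
  have le: "p i \<le> q i" "q i - p i = a i + b i" "enat (q i) \<le> m i" for i
    using k by (auto simp: Omega_def pq le_fun_def fun_eq_iff)
  have q: "q i = p i + a i + b i" for i using le[of i] by simp
  have e: "enat (p i + a i) \<le> m i" for i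
    by (rule order_trans[OF _ le(3)]) (simp add: q)
  show "\<exists>!(\<mu>, \<nu>). \<mu> \<in> paths (Omega m) \<and> \<nu> \<in> paths (Omega m) \<and> deg (Omega m) \<mu> = a \<and> deg (Omega m) \<nu> = b \<and>
          src (Omega m) \<mu> = rng (Omega m) \<nu> \<and> \<kappa> = \<mu> \<cdot>\<^bsub>Omega m\<^esub> \<nu>"
    apply (rule ex1I[of _ "((p,p+a),(p+a,q))"])
    using le e q apply (auto simp: Omega_def pq le_fun_def fun_eq_iff)
    by (metis le_add_diff_inverse)+
qed (auto simp: Omega_def le_fun_def fun_eq_iff intro: order_trans,
    (metis (mono_tags, lifting) order_trans enat_ord_simps(1))+)

text \<open>
  A morphism \<open>x : \<Omega>\<^sub>k\<^sub>,\<^sub>m \<rightarrow> \<Lambda>\<close> is the pair of its degree \<open>m\<close> and its underlying map.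
  The map is required to be \<open>undefined\<close> off the morphisms of \<open>\<Omega>\<^sub>k\<^sub>,\<^sub>m\<close>, so that equality of
  pairs is equality of morphisms (same domain and same values).
\<close>

type_synonym ('a, 'k) omega_map = "('k \<Rightarrow> enat) \<times> (('k \<Rightarrow> nat) \<times> ('k \<Rightarrow> nat) \<Rightarrow> 'a)"

definition odeg :: "('a, 'k) omega_map \<Rightarrow> 'k \<Rightarrow> enat" where
  "odeg x = fst x"

definition oseg :: "('a, 'k) omega_map \<Rightarrow> ('k \<Rightarrow> nat) \<Rightarrow> ('k \<Rightarrow> nat) \<Rightarrow> 'a" where
  "oseg x p q = snd x (p, q)"

abbreviation overt :: "('a, 'k) omega_map \<Rightarrow> ('k \<Rightarrow> nat) \<Rightarrow> 'a" where
  "overt x n \<equiv> oseg x n n"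

abbreviation orng :: "('a, 'k) omega_map \<Rightarrow> 'a" where
  "orng x \<equiv> overt x 0"

definition omega_morphisms :: "('a, 'k) kgraph \<Rightarrow> ('a, 'k) omega_map set" where
  "omega_morphisms \<Lambda> = {(m, f). kgraph_morphism (Omega m) \<Lambda> f \<and> f \<in> extensional (paths (Omega m))}"

definition shift :: "('k \<Rightarrow> nat) \<Rightarrow> ('a, 'k) omega_map \<Rightarrow> ('a, 'k) omega_map" where
  "shift n x = (odeg x - ext n,
     restrict (\<lambda>(p, q). oseg x (n + p) (n + q)) (paths (Omega (odeg x - ext n))))"

text \<open>\<open>prepend \<Lambda> \<kappa> x\<close> is \<open>\<kappa>x\<close>; it is meaningful only for \<open>src \<Lambda> \<kappa> = orng x\<close>.\<close>

definition prepend :: "('a, 'k) kgraph \<Rightarrow> 'a \<Rightarrow> ('a, 'k) omega_map \<Rightarrow> ('a, 'k) omega_map" where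
  "prepend \<Lambda> \<kappa> x = (THE y. y \<in> omega_morphisms \<Lambda> \<and> odeg y = odeg x + ext (deg \<Lambda> \<kappa>) \<and>
     oseg y 0 (deg \<Lambda> \<kappa>) = \<kappa> \<and> shift (deg \<Lambda> \<kappa>) y = x)"

definition boundary_paths :: "('a, 'k) kgraph \<Rightarrow> ('a, 'k) omega_map set" where
  "boundary_paths \<Lambda> = {x \<in> omega_morphisms \<Lambda>.
     \<forall>n. ext n \<le> odeg x \<longrightarrow>
       (\<forall>E \<in> FE \<Lambda> (overt x n). \<exists>p. ext p \<le> odeg x - ext n \<and> oseg x n (n + p) \<in> E)}"

text \<open>The set \<open>\<Lambda>\<^sup>\<le>\<^sup>\<infinity>\<close>.\<close>

definition le_infinity_paths :: "('a, 'k) kgraph \<Rightarrow> ('a, 'k) omega_map set" where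
  "le_infinity_paths \<Lambda> = {x \<in> omega_morphisms \<Lambda>.
     \<exists>n\<^sub>x. ext n\<^sub>x \<le> odeg x \<and>
       (\<forall>n i. n\<^sub>x \<le> n \<and> ext n \<le> odeg x \<and> enat (n i) = odeg x i \<longrightarrow>
          at_vertex \<Lambda> (overt x n) (paths_deg \<Lambda> (gen i)) = {})}"


section \<open>Aperiodicity conditions\<close>

definition aperiodic :: "('a, 'k) kgraph \<Rightarrow> bool" where
  "aperiodic \<Lambda> \<longleftrightarrow>
     (\<forall>\<alpha> \<in> paths \<Lambda>. \<forall>\<beta> \<in> paths \<Lambda>. \<alpha> \<noteq> \<beta> \<and> src \<Lambda> \<alpha> = src \<Lambda> \<beta> \<longrightarrow>
        (\<exists>\<tau> \<in> at_vertex \<Lambda> (src \<Lambda> \<alpha>) (paths \<Lambda>). MCE \<Lambda> (\<alpha> \<cdot>\<^bsub>\<Lambda>\<^esub> \<tau>) (\<beta> \<cdot>\<^bsub>\<Lambda>\<^esub> \<tau>) = {}))"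

definition local_periodicity ::
  "('a, 'k) kgraph \<Rightarrow> ('k \<Rightarrow> nat) \<Rightarrow> ('k \<Rightarrow> nat) \<Rightarrow> 'a \<Rightarrow> bool" where
  "local_periodicity \<Lambda> m n v \<longleftrightarrow>
     (\<forall>x \<in> boundary_paths \<Lambda>. orng x = v \<longrightarrow> ext (sup m n) \<le> odeg x \<and> shift m x = shift n x)"

definition no_local_periodicity :: "('a, 'k) kgraph \<Rightarrow> bool" where
  "no_local_periodicity \<Lambda> \<longleftrightarrow>
     (\<forall>v \<in> verts \<Lambda>. \<forall>m n. m \<noteq> n \<longrightarrow> \<not> local_periodicity \<Lambda> m n v)"

definition condition_A :: "('a, 'k) kgraph \<Rightarrow> bool" where
  "condition_A \<Lambda> \<longleftrightarrow>
     (\<forall>v \<in> verts \<Lambda>. \<exists>x \<in> boundary_paths \<Lambda>. orng x = v \<and>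
        (\<forall>m n. ext m \<le> odeg x \<and> ext n \<le> odeg x \<and> shift m x = shift n x \<longrightarrow> m = n))"

definition condition_B :: "('a, 'k) kgraph \<Rightarrow> bool" where
  "condition_B \<Lambda> \<longleftrightarrow>
     (\<forall>v \<in> verts \<Lambda>. \<exists>x \<in> le_infinity_paths \<Lambda>. orng x = v \<and>
        (\<forall>\<kappa> \<in> paths \<Lambda>. \<forall>\<mu> \<in> paths \<Lambda>. src \<Lambda> \<kappa> = v \<and> src \<Lambda> \<mu> = v \<and> \<kappa> \<noteq> \<mu> \<longrightarrow>
           prepend \<Lambda> \<kappa> x \<noteq> prepend \<Lambda> \<mu> x))"

end

theory Submission
  imports Defs
begin

text \<open>
  Aperiodicity makes each of the countably many requirements in (A) and (B) dense: every path
  extends to one that already forces the requirement. A Baire-type construction then gives a path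
  in \<open>v\<Lambda>\<^sup>\<le>\<^sup>\<infinity> \<subseteq> v(\<partial>\<Lambda>)\<close> meeting all of them. Conversely, suppose that \<open>\<alpha>\<tau>\<close> and \<open>\<beta>\<tau>\<close> have a common
  extension for every \<open>\<tau>\<close>. For a boundary path \<open>x\<close> with initial segment \<open>\<mu>\<close>, the tails \<open>\<nu>\<close> with
  \<open>\<alpha>\<mu>\<nu> \<in> MCE(\<alpha>\<mu>, \<beta>\<mu>)\<close> form a finite exhaustive set (here finite alignment enters), so \<open>\<alpha>x\<close> extends
  \<open>\<beta>\<mu>\<close>. Hence \<open>\<alpha>x = \<beta>x\<close>, which contradicts (B), and comparing the two at degree \<open>d(\<alpha>) \<or> d(\<beta>)\<close>
  gives a local periodicity at \<open>s(\<alpha>)\<close>.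
\<close>

section \<open>Degrees\<close>

text \<open>The degree of the constructed path cannot be prescribed, because a path may reach a
  vertex with no edge in some direction. So each direction carries requirements of its own (grow
  long, or reach such a vertex), and these are what put the limit into
  \<open>\<Lambda>\<^sup>\<le>\<^sup>\<infinity>\<close>. Each requirement must be decided by a
  finite initial segment. For (B) the segment \<mu> is one for which \<alpha>\<mu> and \<beta>\<mu>
  have no common extension. For (A) the two shifts exist only on a path that reaches degree
  \<open>sup m n\<close>, so a segment that can never grow that far also counts as a success. In the
  converse, every tail \<nu> has the same degree m, the excess of
  \<open>sup (deg \<Lambda> \<alpha>) (deg \<Lambda> \<beta>)\<close> over d(\<alpha>), whatever
  \<mu> is. A boundary path that reaches degree N therefore reaches N + m, and by symmetry N + n,
  where n is the excess over d(\<beta>). Its degree is thus infinite wherever d(\<alpha>) and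
  d(\<beta>) differ. This settles all questions of degree: m and n lie below d(x), the two shifts
  have equal degree, and so do \<alpha>x and \<beta>x. The periods found are m and n.\<close>

lemma ext_le_iff: "ext p \<le> ext q \<longleftrightarrow> p \<le> q"
  by (auto simp: le_fun_def)

lemma ext_mono_le: "p \<le> q \<Longrightarrow> ext q \<le> M \<Longrightarrow> ext p \<le> M"
  using ext_le_iff[of p q] order_trans by blast

lemma ext_sup_le: "ext p \<le> M \<Longrightarrow> ext q \<le> M \<Longrightarrow> ext (sup p q) \<le> M"
  by (auto simp: le_fun_def sup_nat_def max_def)

lemma ext_zero_le: "ext 0 \<le> M"
  by (auto simp: le_fun_def zero_enat_def[symmetric])

text \<open>The assumption excludes truncation: if \<open>M i < n i\<close>, the difference is 0 and
  the left side would still hold for \<open>q i = 0\<close>.\<close>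

lemma ext_le_diff_iff:
  assumes "ext n \<le> M"
  shows "ext q \<le> M - ext n \<longleftrightarrow> ext (n + q) \<le> M"
proof -
  have "enat (q i) \<le> M i - enat (n i) \<longleftrightarrow> enat (n i + q i) \<le> M i" for i
    using assms by (cases "M i") (auto simp: le_fun_def dest: spec[of _ i])
  then show ?thesis by (simp add: le_fun_def)
qed

lemma le_fun_iff_ex_add: "p \<le> q \<longleftrightarrow> (\<exists>r. q = p + r)" for p q :: "'k \<Rightarrow> nat"
proof
  assume "p \<le> q"
  then have "q = p + (q - p)" by (auto simp: le_fun_def fun_eq_iff)
  then show "\<exists>r. q = p + r" by blast
qed (auto simp: le_fun_def)

lemma fun_add_diff_cancel [simp]: "(p + q) - p = q" for p q :: "'k \<Rightarrow> nat"
  by (auto simp: fun_eq_iff)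

lemma fun_le_add [simp]: "p \<le> p + q" for p q :: "'k \<Rightarrow> nat"
  by (auto simp: le_fun_def)

lemma zero_le_fun [simp]: "0 \<le> p" for p :: "'k \<Rightarrow> nat"
  by (simp add: le_fun_def)

section \<open>Initial segments and common extensions\<close>

context k_graph
begin

lemma factor_exists:
  assumes "\<kappa> \<in> paths \<Lambda>" "deg \<Lambda> \<kappa> = m + n"
  obtains \<mu> \<nu> where "\<mu> \<in> paths \<Lambda>" "\<nu> \<in> paths \<Lambda>" "deg \<Lambda> \<mu> = m" "deg \<Lambda> \<nu> = n"
    "src \<Lambda> \<mu> = rng \<Lambda> \<nu>" "\<kappa> = \<mu> \<cdot> \<nu>"
  using factorisation[OF assms] by auto

text \<open>Heads of equal degree leave tails of equal degree, since \<nat>^k is cancellative; then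
  both pairs are the same factorisation.\<close>

lemma comp_eq_comp:
  assumes "\<mu> \<in> paths \<Lambda>" "\<nu> \<in> paths \<Lambda>" "src \<Lambda> \<mu> = rng \<Lambda> \<nu>"
    "\<mu>' \<in> paths \<Lambda>" "\<nu>' \<in> paths \<Lambda>" "src \<Lambda> \<mu>' = rng \<Lambda> \<nu>'"
    and "\<mu> \<cdot> \<nu> = \<mu>' \<cdot> \<nu>'" "deg \<Lambda> \<mu> = deg \<Lambda> \<mu>'"
  shows "\<mu> = \<mu>'" "\<nu> = \<nu>'"
proof -
  have "deg \<Lambda> \<mu> + deg \<Lambda> \<nu> = deg \<Lambda> \<mu>' + deg \<Lambda> \<nu>'"
    using assms deg_comp by metis
  then have "deg \<Lambda> \<nu> = deg \<Lambda> \<nu>'" using assms(8) by simp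
  moreover obtain p where p: "\<forall>q. (case q of (a, b) \<Rightarrow> a \<in> paths \<Lambda> \<and> b \<in> paths \<Lambda> \<and> deg \<Lambda> a = deg \<Lambda> \<mu> \<and>
      deg \<Lambda> b = deg \<Lambda> \<nu> \<and> src \<Lambda> a = rng \<Lambda> b \<and> \<mu> \<cdot> \<nu> = a \<cdot> b) \<longrightarrow> q = p"
    using factorisation[OF comp_closed[OF assms(1-3)] deg_comp[OF assms(1-3)]] by (elim ex1E)
  ultimately have "(\<mu>, \<nu>) = p" "(\<mu>', \<nu>') = p"
    using assms spec[OF p, of "(\<mu>, \<nu>)"] spec[OF p, of "(\<mu>', \<nu>')"] by simp_all
  then show "\<mu> = \<mu>'" "\<nu> = \<nu>'" by auto
qed

lemma comp_cancel_left:
  assumes "\<mu> \<in> paths \<Lambda>" "\<nu> \<in> paths \<Lambda>" "src \<Lambda> \<mu> = rng \<Lambda> \<nu>" "\<nu>' \<in> paths \<Lambda>" "src \<Lambda> \<mu> = rng \<Lambda> \<nu>'"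
    and "\<mu> \<cdot> \<nu> = \<mu> \<cdot> \<nu>'"
  shows "\<nu> = \<nu>'"
  using comp_eq_comp(2)[of \<mu> \<nu> \<mu> \<nu>'] assms by blast

lemma comp_cancel_right:
  assumes "\<mu> \<in> paths \<Lambda>" "\<nu> \<in> paths \<Lambda>" "src \<Lambda> \<mu> = rng \<Lambda> \<nu>" "\<mu>' \<in> paths \<Lambda>" "src \<Lambda> \<mu>' = rng \<Lambda> \<nu>"
    and "\<mu> \<cdot> \<nu> = \<mu>' \<cdot> \<nu>"
  shows "\<mu> = \<mu>'"
proof -
  have "deg \<Lambda> \<mu> + deg \<Lambda> \<nu> = deg \<Lambda> \<mu>' + deg \<Lambda> \<nu>"
    using assms deg_comp by metis
  then show ?thesis using comp_eq_comp(1)[of \<mu> \<nu> \<mu>' \<nu>] assms by simp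
qed

text \<open>v followed by its source and its range followed by v are two factorisations of v whose
  heads have degree 0, so they agree.\<close>

lemma deg_zero_eq_rng:
  assumes "v \<in> paths \<Lambda>" "deg \<Lambda> v = 0"
  shows "v = rng \<Lambda> v" "v = src \<Lambda> v"
proof -
  have 1: "rng \<Lambda> v \<in> paths \<Lambda>" "src \<Lambda> v \<in> paths \<Lambda>" using assms rng_closed src_closed by auto
  have "v \<cdot> src \<Lambda> v = rng \<Lambda> v \<cdot> v" using assms by (simp add: comp_rng comp_src)
  note eq = comp_eq_comp[OF assms(1) 1(2) rng_src[OF assms(1), symmetric] 1(1) assms(1) src_rng[OF assms(1)] this]
  show "v = rng \<Lambda> v" "v = src \<Lambda> v"
    using eq assms by (simp_all add: deg_rng)
qed

lemma vertsD:
  assumes "v \<in> verts \<Lambda>"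
  shows "v \<in> paths \<Lambda>" "deg \<Lambda> v = 0" "rng \<Lambda> v = v" "src \<Lambda> v = v"
  using assms deg_zero_eq_rng[of v] by (auto simp: paths_deg_def)

lemma src_in_verts: "\<mu> \<in> paths \<Lambda> \<Longrightarrow> src \<Lambda> \<mu> \<in> verts \<Lambda>"
  by (simp add: paths_deg_def src_closed deg_src)

lemma segment_comp:
  assumes "a \<in> paths \<Lambda>" "b \<in> paths \<Lambda>" "c \<in> paths \<Lambda>" "src \<Lambda> a = rng \<Lambda> b" "src \<Lambda> b = rng \<Lambda> c"
  shows "segment \<Lambda> (a \<cdot> b \<cdot> c) (deg \<Lambda> a) (deg \<Lambda> a + deg \<Lambda> b) = b"
  unfolding segment_def
proof (rule the_equality, goal_cases)
  case 1
  have "deg \<Lambda> (a \<cdot> b \<cdot> c) = deg \<Lambda> a + deg \<Lambda> b + deg \<Lambda> c"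
    using assms by (simp add: deg_comp comp_closed src_comp)
  then show ?case using assms by (auto simp: paths_deg_def)
next
  case (2 \<mu>)
  then obtain a' c' where *: "a' \<in> paths \<Lambda>" "c' \<in> paths \<Lambda>" "\<mu> \<in> paths \<Lambda>" "deg \<Lambda> a' = deg \<Lambda> a"
    "deg \<Lambda> \<mu> = deg \<Lambda> b"
    "src \<Lambda> a' = rng \<Lambda> \<mu>" "src \<Lambda> \<mu> = rng \<Lambda> c'" "a \<cdot> b \<cdot> c = a' \<cdot> \<mu> \<cdot> c'"
    by (auto simp: paths_deg_def)
  have "a \<cdot> b = a' \<cdot> \<mu>"
    by (rule comp_eq_comp(1)[of _ c _ c'])
       (use * assms in \<open>auto simp: deg_comp comp_closed src_comp\<close>)
  then show ?case
    using comp_eq_comp(2)[of a b a' \<mu>] * assms by simp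
qed

text \<open>The prefix order. Phrasing everything through it avoids the definite description in
  \<open>segment\<close>. Membership in \<open>paths \<Lambda>\<close> is demanded because
  composition is a total function.\<close>

definition initial :: "'a \<Rightarrow> 'a \<Rightarrow> bool" (infix "\<preceq>" 50) where
  "\<mu> \<preceq> \<kappa> \<longleftrightarrow> (\<exists>\<tau> \<in> paths \<Lambda>. \<mu> \<in> paths \<Lambda> \<and> src \<Lambda> \<mu> = rng \<Lambda> \<tau> \<and> \<kappa> = \<mu> \<cdot> \<tau>)"

lemma initialE:
  assumes "\<mu> \<preceq> \<kappa>"
  obtains \<tau> where "\<mu> \<in> paths \<Lambda>" "\<tau> \<in> paths \<Lambda>" "src \<Lambda> \<mu> = rng \<Lambda> \<tau>" "\<kappa> = \<mu> \<cdot> \<tau>"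
  using assms by (auto simp: initial_def)

lemma initial_compI: "\<mu> \<in> paths \<Lambda> \<Longrightarrow> \<tau> \<in> paths \<Lambda> \<Longrightarrow> src \<Lambda> \<mu> = rng \<Lambda> \<tau> \<Longrightarrow> \<mu> \<preceq> \<mu> \<cdot> \<tau>"
  by (auto simp: initial_def)

lemma initialD:
  assumes "\<mu> \<preceq> \<kappa>"
  shows "\<mu> \<in> paths \<Lambda>" "\<kappa> \<in> paths \<Lambda>" "rng \<Lambda> \<mu> = rng \<Lambda> \<kappa>" "deg \<Lambda> \<mu> \<le> deg \<Lambda> \<kappa>"
  using assms by (auto elim!: initialE simp: comp_closed rng_comp deg_comp)

lemma initial_refl: "\<mu> \<in> paths \<Lambda> \<Longrightarrow> \<mu> \<preceq> \<mu>"
  using initial_compI[of \<mu> "src \<Lambda> \<mu>"] by (simp add: comp_src src_closed rng_src)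

lemma initial_trans [trans]:
  assumes "\<xi> \<preceq> \<mu>" "\<mu> \<preceq> \<kappa>"
  shows "\<xi> \<preceq> \<kappa>"
proof -
  obtain a where a: "\<xi> \<in> paths \<Lambda>" "a \<in> paths \<Lambda>" "src \<Lambda> \<xi> = rng \<Lambda> a" "\<mu> = \<xi> \<cdot> a"
    using assms(1) by (rule initialE)
  obtain b where b: "b \<in> paths \<Lambda>" "src \<Lambda> \<mu> = rng \<Lambda> b" "\<kappa> = \<mu> \<cdot> b"
    using assms(2) by (rule initialE)
  show ?thesis
    using initial_compI[of \<xi> "a \<cdot> b"] a b by (simp add: comp_assoc comp_closed rng_comp src_comp)
qed

lemma initial_comp_left:
  assumes "\<mu> \<preceq> \<kappa>" "\<alpha> \<in> paths \<Lambda>" "src \<Lambda> \<alpha> = rng \<Lambda> \<mu>"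
  shows "\<alpha> \<cdot> \<mu> \<preceq> \<alpha> \<cdot> \<kappa>"
proof -
  obtain a where a: "\<mu> \<in> paths \<Lambda>" "a \<in> paths \<Lambda>" "src \<Lambda> \<mu> = rng \<Lambda> a" "\<kappa> = \<mu> \<cdot> a"
    using assms(1) by (rule initialE)
  then show ?thesis
    using initial_compI[of "\<alpha> \<cdot> \<mu>" a] assms by (simp add: comp_assoc comp_closed src_comp)
qed

text \<open>Left cancellation of \<alpha>. This moves prefix relations back from common extensions
  of longer paths to their tails.\<close>

lemma initial_comp_cancel:
  assumes "\<alpha> \<cdot> \<mu> \<preceq> \<alpha> \<cdot> \<kappa>" "\<alpha> \<in> paths \<Lambda>" "src \<Lambda> \<alpha> = rng \<Lambda> \<mu>" "src \<Lambda> \<alpha> = rng \<Lambda> \<kappa>"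
    "\<mu> \<in> paths \<Lambda>" "\<kappa> \<in> paths \<Lambda>"
  shows "\<mu> \<preceq> \<kappa>"
proof -
  obtain a where a: "a \<in> paths \<Lambda>" "src \<Lambda> (\<alpha> \<cdot> \<mu>) = rng \<Lambda> a" "\<alpha> \<cdot> \<kappa> = \<alpha> \<cdot> \<mu> \<cdot> a"
    using assms(1) by (rule initialE)
  have s: "src \<Lambda> \<mu> = rng \<Lambda> a" using a(2) assms by (simp add: src_comp)
  have "\<alpha> \<cdot> \<kappa> = \<alpha> \<cdot> (\<mu> \<cdot> a)"
    unfolding a(3) using comp_assoc[OF assms(2,5) a(1) assms(3) s] .
  then have "\<kappa> = \<mu> \<cdot> a"
    by (rule comp_cancel_left[OF assms(2,6,4) comp_closed[OF assms(5) a(1) s], rotated])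
      (use assms(3) rng_comp[OF assms(5) a(1) s] in simp)
  then show ?thesis
    using a(1) s assms(5) initial_compI by blast
qed

lemma initial_eq: "\<mu> \<preceq> \<kappa> \<Longrightarrow> \<nu> \<preceq> \<kappa> \<Longrightarrow> deg \<Lambda> \<mu> = deg \<Lambda> \<nu> \<Longrightarrow> \<mu> = \<nu>"
  by (elim initialE) (auto dest: comp_eq_comp(1)[rotated 6])

lemma initial_exists:
  assumes "\<kappa> \<in> paths \<Lambda>" "n \<le> deg \<Lambda> \<kappa>"
  obtains \<mu> where "\<mu> \<preceq> \<kappa>" "deg \<Lambda> \<mu> = n"
proof -
  obtain r where "deg \<Lambda> \<kappa> = n + r" using assms(2) le_fun_iff_ex_add by blast
  with assms(1) obtain \<mu> \<nu> where "\<mu> \<in> paths \<Lambda>" "\<nu> \<in> paths \<Lambda>" "deg \<Lambda> \<mu> = n"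
    "src \<Lambda> \<mu> = rng \<Lambda> \<nu>" "\<kappa> = \<mu> \<cdot> \<nu>"
    by (rule factor_exists)
  with that initial_compI show thesis by blast
qed

text \<open>Truncating \<nu> at the degree of \<mu> gives a prefix of \<kappa> of that degree, and
  there is only one.\<close>

lemma initial_linear:
  assumes "\<mu> \<preceq> \<kappa>" "\<nu> \<preceq> \<kappa>" "deg \<Lambda> \<mu> \<le> deg \<Lambda> \<nu>"
  shows "\<mu> \<preceq> \<nu>"
proof -
  obtain \<mu>' where "\<mu>' \<preceq> \<nu>" "deg \<Lambda> \<mu>' = deg \<Lambda> \<mu>"
    using initial_exists[OF initialD(1)[OF assms(2)] assms(3)] by blast
  then show ?thesis using initial_eq[of \<mu>' \<kappa> \<mu>] assms initial_trans by blast
qed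

lemma segment_initial:
  assumes "\<mu> \<preceq> \<kappa>"
  shows "segment \<Lambda> \<kappa> 0 (deg \<Lambda> \<mu>) = \<mu>"
proof -
  obtain \<tau> where "\<mu> \<in> paths \<Lambda>" "\<tau> \<in> paths \<Lambda>" "src \<Lambda> \<mu> = rng \<Lambda> \<tau>" "\<kappa> = \<mu> \<cdot> \<tau>"
    using assms by (rule initialE)
  then show ?thesis
    using segment_comp[of "rng \<Lambda> \<mu>" \<mu> \<tau>] by (simp add: comp_rng deg_rng rng_closed src_rng)
qed

lemma MCE_iff:
  assumes "\<mu> \<in> paths \<Lambda>" "\<nu> \<in> paths \<Lambda>"
  shows "\<kappa> \<in> MCE \<Lambda> \<mu> \<nu> \<longleftrightarrow> deg \<Lambda> \<kappa> = sup (deg \<Lambda> \<mu>) (deg \<Lambda> \<nu>) \<and> \<mu> \<preceq> \<kappa> \<and> \<nu> \<preceq> \<kappa>"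
proof
  assume k: "\<kappa> \<in> MCE \<Lambda> \<mu> \<nu>"
  have "\<xi> \<preceq> \<kappa>" if seg: "segment \<Lambda> \<kappa> 0 (deg \<Lambda> \<xi>) = \<xi>" and le: "deg \<Lambda> \<xi> \<le> deg \<Lambda> \<kappa>" for \<xi>
  proof -
    have "\<kappa> \<in> paths \<Lambda>" using k by (simp add: MCE_def)
    then obtain \<mu>' where m: "\<mu>' \<preceq> \<kappa>" "deg \<Lambda> \<mu>' = deg \<Lambda> \<xi>"
      using le by (rule initial_exists)
    have "\<mu>' = \<xi>" using segment_initial[OF m(1)] seg unfolding m(2) by (rule trans[OF sym])
    with m(1) show ?thesis by blast
  qed
  then show "deg \<Lambda> \<kappa> = sup (deg \<Lambda> \<mu>) (deg \<Lambda> \<nu>) \<and> \<mu> \<preceq> \<kappa> \<and> \<nu> \<preceq> \<kappa>"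
    using k by (auto simp: MCE_def)
next
  assume "deg \<Lambda> \<kappa> = sup (deg \<Lambda> \<mu>) (deg \<Lambda> \<nu>) \<and> \<mu> \<preceq> \<kappa> \<and> \<nu> \<preceq> \<kappa>"
  then show "\<kappa> \<in> MCE \<Lambda> \<mu> \<nu>"
    using initialD(2) segment_initial by (auto simp: MCE_def)
qed

text \<open>Truncate \<kappa> at the join of the two degrees. Hence a minimal common extension
  exists as soon as any common extension does.\<close>

lemma MCE_below:
  assumes "\<mu> \<preceq> \<kappa>" "\<nu> \<preceq> \<kappa>"
  obtains \<theta> where "\<theta> \<in> MCE \<Lambda> \<mu> \<nu>" "\<theta> \<preceq> \<kappa>"
proof -
  obtain \<theta> where t: "\<theta> \<preceq> \<kappa>" "deg \<Lambda> \<theta> = sup (deg \<Lambda> \<mu>) (deg \<Lambda> \<nu>)"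
    using initial_exists[of \<kappa> "sup (deg \<Lambda> \<mu>) (deg \<Lambda> \<nu>)"] assms[THEN initialD(4)] initialD(2)[OF assms(1)]
    by auto
  moreover have "\<mu> \<preceq> \<theta>" "\<nu> \<preceq> \<theta>"
    using assms t by (auto intro!: initial_linear[of _ \<kappa> \<theta>])
  ultimately show thesis
    using that MCE_iff[OF assms[THEN initialD(1)]] by blast
qed

lemma MCE_nonempty_iff:
  assumes "\<mu> \<in> paths \<Lambda>" "\<nu> \<in> paths \<Lambda>"
  shows "MCE \<Lambda> \<mu> \<nu> \<noteq> {} \<longleftrightarrow> (\<exists>\<kappa>. \<mu> \<preceq> \<kappa> \<and> \<nu> \<preceq> \<kappa>)"
  using MCE_iff[OF assms] MCE_below by (metis ex_in_conv)

text \<open>The vertex condition from the definition of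
  \<open>\<Lambda>\<^sup>\<le>\<^sup>\<infinity>\<close>, attached to the path that ends at the
  vertex, which makes it monotone in the prefix order.\<close>

definition dead :: "'k \<Rightarrow> 'a \<Rightarrow> bool" where
  "dead i \<mu> \<longleftrightarrow> at_vertex \<Lambda> (src \<Lambda> \<mu>) (paths_deg \<Lambda> (gen i)) = {}"

text \<open>If \<kappa> = \<mu>a and an edge f of degree \<open>gen i\<close> followed \<kappa>,
  then af could be factored again with an edge of that degree in front, and this edge would follow
  \<mu>.\<close>

lemma dead_mono:
  assumes "dead i \<mu>" "\<mu> \<preceq> \<kappa>"
  shows "dead i \<kappa>"
proof (rule ccontr)
  assume "\<not> dead i \<kappa>"
  then obtain f where f: "f \<in> paths \<Lambda>" "rng \<Lambda> f = src \<Lambda> \<kappa>" "deg \<Lambda> f = gen i"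
    by (auto simp: dead_def at_vertex_def paths_deg_def)
  obtain a where a: "\<mu> \<in> paths \<Lambda>" "a \<in> paths \<Lambda>" "src \<Lambda> \<mu> = rng \<Lambda> a" "\<kappa> = \<mu> \<cdot> a"
    using assms(2) by (rule initialE)
  have af: "a \<cdot> f \<in> paths \<Lambda>" "deg \<Lambda> (a \<cdot> f) = gen i + deg \<Lambda> a"
    using a f by (auto simp: comp_closed deg_comp src_comp add.commute)
  obtain e where e: "e \<preceq> a \<cdot> f" "deg \<Lambda> e = gen i"
    using initial_exists[of "a \<cdot> f" "gen i"] af by auto
  have "rng \<Lambda> e = src \<Lambda> \<mu>"
    using initialD(3)[OF e(1)] a f by (simp add: rng_comp src_comp)
  then have "e \<in> at_vertex \<Lambda> (src \<Lambda> \<mu>) (paths_deg \<Lambda> (gen i))"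
    using e initialD(1)[OF e(1)] by (simp add: at_vertex_def paths_deg_def)
  then show False using assms(1) by (auto simp: dead_def)
qed

section \<open>Morphisms from \<open>\<Omega>\<^sub>k\<^sub>,\<^sub>m\<close> as limits\<close>

lemma omegaD:
  assumes "x \<in> omega_morphisms \<Lambda>" "p \<le> q" "ext q \<le> odeg x"
  shows "oseg x p q \<in> paths \<Lambda>" "deg \<Lambda> (oseg x p q) = q - p"
    "rng \<Lambda> (oseg x p q) = overt x p" "src \<Lambda> (oseg x p q) = overt x q"
proof -
  have x: "kgraph_morphism (Omega (odeg x)) \<Lambda> (snd x)"
    using assms(1) by (auto simp: omega_morphisms_def odeg_def)
  have pq: "(p, q) \<in> paths (Omega (odeg x))" using assms by (simp add: Omega_def)
  show "oseg x p q \<in> paths \<Lambda>" "deg \<Lambda> (oseg x p q) = q - p"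
    "rng \<Lambda> (oseg x p q) = overt x p" "src \<Lambda> (oseg x p q) = overt x q"
    using bspec[OF conjunct1[OF x[unfolded kgraph_morphism_def]] pq] by (simp_all add: Omega_def oseg_def)
qed

lemma oseg_comp:
  assumes "x \<in> omega_morphisms \<Lambda>" "p \<le> q" "q \<le> l" "ext l \<le> odeg x"
  shows "oseg x p q \<cdot> oseg x q l = oseg x p l"
proof -
  have x: "kgraph_morphism (Omega (odeg x)) \<Lambda> (snd x)"
    using assms(1) by (auto simp: omega_morphisms_def odeg_def)
  have pq: "(p, q) \<in> paths (Omega (odeg x))" "(q, l) \<in> paths (Omega (odeg x))"
    using assms ext_mono_le[OF assms(3,4)] by (simp_all add: Omega_def)
  show ?thesis
    using bspec[OF bspec[OF conjunct2[OF x[unfolded kgraph_morphism_def]] pq(1)] pq(2)]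
    by (simp add: Omega_def oseg_def)
qed

lemma omegaI:
  assumes "f \<in> extensional (paths (Omega M))"
    and "\<And>p q. p \<le> q \<Longrightarrow> ext q \<le> M \<Longrightarrow> f (p, q) \<in> paths \<Lambda> \<and> deg \<Lambda> (f (p, q)) = q - p \<and>
      rng \<Lambda> (f (p, q)) = f (p, p) \<and> src \<Lambda> (f (p, q)) = f (q, q)"
    and "\<And>p q l. p \<le> q \<Longrightarrow> q \<le> l \<Longrightarrow> ext l \<le> M \<Longrightarrow> f (p, q) \<cdot> f (q, l) = f (p, l)"
  shows "(M, f) \<in> omega_morphisms \<Lambda>"
proof -
  have "kgraph_morphism (Omega M) \<Lambda> f"
    unfolding kgraph_morphism_def Omega_def using assms(2,3) by simp
  with assms(1) show ?thesis by (simp add: omega_morphisms_def)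
qed

lemma oseg_initial:
  assumes "x \<in> omega_morphisms \<Lambda>" "q \<le> l" "ext l \<le> odeg x"
  shows "oseg x 0 q \<preceq> oseg x 0 l"
proof -
  have q: "ext q \<le> odeg x" "0 \<le> q" using ext_mono_le[OF assms(2,3)] by simp_all
  show ?thesis
    using initial_compI[of "oseg x 0 q" "oseg x q l"] oseg_comp[OF assms(1) q(2) assms(2,3)]
      omegaD[OF assms(1) q(2,1)] omegaD[OF assms] by simp
qed

lemma initial_oseg_eq:
  assumes "x \<in> omega_morphisms \<Lambda>" "ext l \<le> odeg x" "\<mu> \<preceq> oseg x 0 l"
  shows "oseg x 0 (deg \<Lambda> \<mu>) = \<mu>"
proof -
  have 0: "0 \<le> l" "0 \<le> deg \<Lambda> \<mu>" by simp_all
  have "deg \<Lambda> \<mu> \<le> l"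
    using initialD(4)[OF assms(3)] omegaD(2)[OF assms(1) 0(1) assms(2)] by simp
  then show ?thesis
    using initial_eq[OF oseg_initial[OF assms(1) _ assms(2)] assms(3)]
      omegaD(2)[OF assms(1) 0(2)] ext_mono_le[OF _ assms(2)] by simp
qed

text \<open>Initial segments determine a morphism: x(p,q) is recovered from x(0,q) by cancelling
  x(0,p), and outside the domain both maps are \<open>undefined\<close>.\<close>

lemma omega_eqI:
  assumes x: "x \<in> omega_morphisms \<Lambda>" and y: "y \<in> omega_morphisms \<Lambda>" and d: "odeg x = odeg y"
    and eq: "\<And>q. ext q \<le> odeg x \<Longrightarrow> oseg x 0 q = oseg y 0 q"
  shows "x = y"
proof -
  have *: "oseg x p q = oseg y p q" if pq: "p \<le> q" "ext q \<le> odeg x" for p q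
  proof -
    have p: "ext p \<le> odeg x" "0 \<le> p" using ext_mono_le[OF that] by simp_all
    have e: "oseg y 0 p \<cdot> oseg x p q = oseg y 0 p \<cdot> oseg y p q"
      using oseg_comp[OF x p(2) pq] oseg_comp[OF y p(2) pq(1)] eq[OF pq(2)] eq[OF p(1)] pq(2) d
      by simp
    note X = omegaD[OF x pq] omegaD[OF x p(2,1)]
    note Y = omegaD[OF y pq(1)] omegaD[OF y p(2)]
    show ?thesis
      by (rule comp_cancel_left[OF _ _ _ _ _ e])
        (use X Y pq p eq[OF p(1)] d in simp_all)
  qed
  have "snd x \<in> extensional (paths (Omega (odeg x)))" "snd y \<in> extensional (paths (Omega (odeg x)))"
    using x y d by (auto simp: omega_morphisms_def odeg_def)
  then have "snd x = snd y"
    by (rule extensionalityI) (use * in \<open>auto simp: Omega_def oseg_def\<close>)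
  with d show ?thesis by (simp add: odeg_def prod_eq_iff)
qed

section \<open>Shifts of morphisms\<close>

lemma odeg_shift [simp]: "odeg (shift n x) = odeg x - ext n"
  by (simp add: shift_def odeg_def)

lemma oseg_shift:
  assumes "p \<le> q" "ext (n + q) \<le> odeg x"
  shows "oseg (shift n x) p q = oseg x (n + p) (n + q)"
proof -
  have "ext n \<le> odeg x" by (rule ext_mono_le[OF _ assms(2)]) (simp add: le_fun_def)
  then have "ext q \<le> odeg x - ext n" using assms(2) by (simp only: ext_le_diff_iff)
  then show ?thesis using assms(1) by (simp add: shift_def oseg_def Omega_def)
qed

lemma shift_in_omega:
  assumes x: "x \<in> omega_morphisms \<Lambda>" and n: "ext n \<le> odeg x"
  shows "shift n x \<in> omega_morphisms \<Lambda>"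
proof -
  have seg: "snd (shift n x) (p, q) = oseg x (n + p) (n + q)" "n + p \<le> n + q" "ext (n + q) \<le> odeg x"
    "ext (n + p) \<le> odeg x"
    if "p \<le> q" "ext q \<le> odeg x - ext n" for p q
  proof -
    show nq: "ext (n + q) \<le> odeg x" "n + p \<le> n + q"
      using that by (simp_all only: ext_le_diff_iff[OF n]) (simp add: le_fun_def)
    show "snd (shift n x) (p, q) = oseg x (n + p) (n + q)"
      using oseg_shift[OF that(1) nq(1)] unfolding oseg_def[of "shift n x"] .
    show "ext (n + p) \<le> odeg x" by (rule ext_mono_le[OF nq(2,1)])
  qed
  have d: "(n + q) - (n + p) = q - p" for p q :: "'k \<Rightarrow> nat" by (auto simp: fun_eq_iff)
  have p: "ext p \<le> odeg x - ext n" if "p \<le> q" "ext q \<le> odeg x - ext n" for p q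
    using that by (rule ext_mono_le)
  have "(odeg x - ext n, snd (shift n x)) \<in> omega_morphisms \<Lambda>"
  proof (rule omegaI, goal_cases)
    case 1
    show ?case by (simp add: shift_def)
  next
    case (2 p q)
    show ?case
      using omegaD[OF x, of "n + p" "n + q", OF seg(2,3)[OF 2]] seg(1)[OF 2] seg(1)[OF order_refl p[OF 2]]
        seg(1)[OF order_refl 2(2)] by (simp add: d)
  next
    case (3 p q l)
    have "p \<le> l" using 3 by simp
    then show ?case
      using oseg_comp[OF x, of "n + p" "n + q" "n + l"] 3 p seg by metis
  qed
  then show ?thesis by (simp add: shift_def)
qed

lemma shift_eq_iff:
  assumes x: "x \<in> omega_morphisms \<Lambda>" and m: "ext m \<le> odeg x" and n: "ext n \<le> odeg x"
  shows "shift m x = shift n x \<longleftrightarrow> odeg x - ext m = odeg x - ext n \<and>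
    (\<forall>q. ext (m + q) \<le> odeg x \<longrightarrow> oseg x m (m + q) = oseg x n (n + q))"
proof
  have z: "0 \<le> q" for q :: "'k \<Rightarrow> nat" by (simp add: le_fun_def)
  have le: "ext (m + q) \<le> odeg x \<longleftrightarrow> ext (n + q) \<le> odeg x" if "odeg x - ext m = odeg x - ext n" for q
    using that ext_le_diff_iff[OF m] ext_le_diff_iff[OF n] by metis
  {
    assume eq: "shift m x = shift n x"
    then have d: "odeg x - ext m = odeg x - ext n" by (metis odeg_shift)
    have "oseg x m (m + q) = oseg x n (n + q)" if "ext (m + q) \<le> odeg x" for q
      using oseg_shift[OF z that] oseg_shift[OF z that[unfolded le[OF d]]] eq by simp
    with d show "odeg x - ext m = odeg x - ext n \<and>
      (\<forall>q. ext (m + q) \<le> odeg x \<longrightarrow> oseg x m (m + q) = oseg x n (n + q))" by blast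
  next
    assume *: "odeg x - ext m = odeg x - ext n \<and>
      (\<forall>q. ext (m + q) \<le> odeg x \<longrightarrow> oseg x m (m + q) = oseg x n (n + q))"
    show "shift m x = shift n x"
    proof (rule omega_eqI)
      fix q assume "ext q \<le> odeg (shift m x)"
      then have q: "ext (m + q) \<le> odeg x" using ext_le_diff_iff[OF m] by (metis odeg_shift)
      then have q': "ext (n + q) \<le> odeg x" using le * by blast
      show "oseg (shift m x) 0 q = oseg (shift n x) 0 q"
        using oseg_shift[OF z q] oseg_shift[OF z q'] * q by simp
    qed (use * x m n shift_in_omega in auto)
  }
qed

section \<open>Limits of compatible families of finite paths\<close>

lemma tower_limit:
  assumes g: "\<And>q. ext q \<le> M \<Longrightarrow> deg \<Lambda> (g q) = q"
    and mono: "\<And>p q. p \<le> q \<Longrightarrow> ext q \<le> M \<Longrightarrow> g p \<preceq> g q"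
  shows "\<exists>x \<in> omega_morphisms \<Lambda>. odeg x = M \<and> (\<forall>q. ext q \<le> M \<longrightarrow> oseg x 0 q = g q)"
proof -
  \<comment> \<open>The value at (p,q) is forced: it is the tail of \<open>g q\<close> after
    \<open>g p\<close>. Left cancellation makes it unique, and uniqueness yields compatibility with
    composition and the values at vertices.\<close>
  define R where "R p q \<nu> \<longleftrightarrow> \<nu> \<in> paths \<Lambda> \<and> src \<Lambda> (g p) = rng \<Lambda> \<nu> \<and> g q = g p \<cdot> \<nu>" for p q \<nu>
  define f where "f = restrict (\<lambda>(p, q). SOME \<nu>. R p q \<nu>) (paths (Omega M))"
  have gp: "g p \<in> paths \<Lambda>" if "ext p \<le> M" for p
    using initialD(1)[OF mono[OF order_refl that]] .
  have R: "R p q (f (p, q))" if "p \<le> q" "ext q \<le> M" for p q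
  proof -
    have "\<exists>\<nu>. R p q \<nu>" using initialE[OF mono[OF that]] unfolding R_def by metis
    then have "R p q (SOME \<nu>. R p q \<nu>)" by (rule someI_ex)
    then show ?thesis using that by (simp add: f_def Omega_def)
  qed
  have uniq: "\<nu> = f (p, q)" if "R p q \<nu>" "p \<le> q" "ext q \<le> M" for p q \<nu>
  proof -
    have "g p \<cdot> \<nu> = g p \<cdot> f (p, q)" using R[OF that(2,3)] that(1) by (simp add: R_def)
    then show ?thesis
      using comp_cancel_left[OF gp[OF ext_mono_le[OF that(2,3)]]] R[OF that(2,3)] that(1)
      unfolding R_def by blast
  qed
  have vert: "f (p, p) = src \<Lambda> (g p)" if "ext p \<le> M" for p
    by (rule uniq[OF _ order_refl that, symmetric])
      (use gp[OF that] in \<open>simp add: R_def comp_src src_closed rng_src\<close>)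
  have "(M, f) \<in> omega_morphisms \<Lambda>"
  proof (rule omegaI, goal_cases)
    case 1
    show ?case by (simp add: f_def)
  next
    case (2 p q)
    note p = ext_mono_le[OF 2]
    from R[OF 2] have r: "f (p, q) \<in> paths \<Lambda>" "src \<Lambda> (g p) = rng \<Lambda> (f (p, q))" "g q = g p \<cdot> f (p, q)"
      by (simp_all add: R_def)
    have "q = p + deg \<Lambda> (f (p, q))"
      using deg_comp[OF gp[OF p] r(1,2)] g[OF p] g[OF 2(2)] r(3) by simp
    then have "deg \<Lambda> (f (p, q)) = q - p" by (metis fun_add_diff_cancel)
    moreover have "src \<Lambda> (g q) = src \<Lambda> (f (p, q))"
      using src_comp[OF gp[OF p] r(1,2)] r(3) by simp
    ultimately show ?case using r vert[OF p] vert[OF 2(2)] by simp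
  next
    case (3 p q l)
    note q = ext_mono_le[OF 3(2,3)]
    note p = ext_mono_le[OF 3(1) q]
    from R[OF 3(1) q] have r: "f (p, q) \<in> paths \<Lambda>" "src \<Lambda> (g p) = rng \<Lambda> (f (p, q))" "g q = g p \<cdot> f (p, q)"
      by (simp_all add: R_def)
    from R[OF 3(2,3)] have r': "f (q, l) \<in> paths \<Lambda>" "src \<Lambda> (g q) = rng \<Lambda> (f (q, l))" "g l = g q \<cdot> f (q, l)"
      by (simp_all add: R_def)
    have s: "src \<Lambda> (f (p, q)) = rng \<Lambda> (f (q, l))"
      using src_comp[OF gp[OF p] r(1,2)] r(3) r'(2) by simp
    show ?case
    proof (rule uniq)
      show "R p l (f (p, q) \<cdot> f (q, l))"
        unfolding R_def
        using comp_assoc[OF gp[OF p] r(1) r'(1) r(2) s] r r' s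
        by (simp add: comp_closed rng_comp)
    qed (use 3 in auto)
  qed
  moreover have "f (0, q) = g q" if "ext q \<le> M" for q
  proof (rule uniq[symmetric])
    have "g 0 \<preceq> g q" "deg \<Lambda> (g 0) = 0" using mono[OF _ that, of 0] g[of 0, OF ext_zero_le] by simp_all
    then have "src \<Lambda> (g 0) = g 0" "rng \<Lambda> (g 0) = g 0" "rng \<Lambda> (g 0) = rng \<Lambda> (g q)"
      using deg_zero_eq_rng[of "g 0"] initialD by auto
    then show "R 0 q (g q)" using comp_rng[OF gp[OF that]] gp[OF that] by (simp add: R_def)
  qed (use that in \<open>auto simp: le_fun_def\<close>)
  ultimately show ?thesis by (intro bexI[of _ "(M, f)"]) (simp_all add: odeg_def oseg_def)
qed

text \<open>Prefixes of members of F are compared by degree alone, because any two members have a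
  common extension. So the choice of a prefix of each degree is harmless, and the chosen prefixes
  form a tower.\<close>

lemma directed_limit:
  assumes cofinal: "\<And>q. ext q \<le> M \<Longrightarrow> \<exists>\<kappa>\<in>F. q \<le> deg \<Lambda> \<kappa>"
    and F: "F \<subseteq> paths \<Lambda>"
    and directed: "\<And>\<mu> \<nu>. \<mu> \<in> F \<Longrightarrow> \<nu> \<in> F \<Longrightarrow> \<exists>\<kappa>. \<mu> \<preceq> \<kappa> \<and> \<nu> \<preceq> \<kappa>"
  shows "\<exists>x \<in> omega_morphisms \<Lambda>. odeg x = M \<and>
    (\<forall>\<kappa>\<in>F. \<forall>\<mu>. \<mu> \<preceq> \<kappa> \<longrightarrow> ext (deg \<Lambda> \<mu>) \<le> M \<longrightarrow> oseg x 0 (deg \<Lambda> \<mu>) = \<mu>)"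
proof -
  have linear: "\<mu> \<preceq> \<nu>" if i: "\<mu> \<preceq> \<kappa>" "\<kappa> \<in> F" "\<nu> \<preceq> \<kappa>'" "\<kappa>' \<in> F" "deg \<Lambda> \<mu> \<le> deg \<Lambda> \<nu>" for \<mu> \<nu> \<kappa> \<kappa>'
  proof -
    obtain \<theta> where "\<kappa> \<preceq> \<theta>" "\<kappa>' \<preceq> \<theta>" using directed[OF i(2,4)] by blast
    then show ?thesis using initial_linear[OF initial_trans[OF i(1)] initial_trans[OF i(3)] i(5)] by blast
  qed
  define g where "g q = (SOME \<mu>. deg \<Lambda> \<mu> = q \<and> (\<exists>\<kappa>\<in>F. \<mu> \<preceq> \<kappa>))" for q
  have g: "deg \<Lambda> (g q) = q \<and> (\<exists>\<kappa>\<in>F. g q \<preceq> \<kappa>)" if q: "ext q \<le> M" for q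
  proof -
    obtain \<kappa> where k: "\<kappa> \<in> F" "q \<le> deg \<Lambda> \<kappa>" using cofinal[OF q] by blast
    with F have "\<kappa> \<in> paths \<Lambda>" by blast
    then obtain \<mu> where "\<mu> \<preceq> \<kappa>" "deg \<Lambda> \<mu> = q" using k(2) by (rule initial_exists)
    then have "\<exists>\<mu>. deg \<Lambda> \<mu> = q \<and> (\<exists>\<kappa>\<in>F. \<mu> \<preceq> \<kappa>)" using k by blast
    then show ?thesis unfolding g_def by (rule someI_ex)
  qed
  have g_deg: "deg \<Lambda> (g q) = q" if "ext q \<le> M" for q
    using g[OF that] by blast
  have g_mono: "g p \<preceq> g q" if "p \<le> q" "ext q \<le> M" for p q
    using linear g[OF that(2)] g[OF ext_mono_le[OF that]] that(1) by metis
  obtain x where x: "x \<in> omega_morphisms \<Lambda>" "odeg x = M" "\<And>q. ext q \<le> M \<Longrightarrow> oseg x 0 q = g q"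
    using tower_limit[OF g_deg g_mono] by blast
  show ?thesis
  proof (intro bexI[OF _ x(1)] conjI ballI allI impI x(2))
    fix \<mu> \<kappa> assume k: "\<kappa> \<in> F" "\<mu> \<preceq> \<kappa>" and le: "ext (deg \<Lambda> \<mu>) \<le> M"
    from g[OF le] obtain \<kappa>' where k': "\<kappa>' \<in> F" "g (deg \<Lambda> \<mu>) \<preceq> \<kappa>'" "deg \<Lambda> (g (deg \<Lambda> \<mu>)) = deg \<Lambda> \<mu>"
      by blast
    have "g (deg \<Lambda> \<mu>) \<preceq> \<mu>" using linear[OF k'(2,1) k(2,1)] k'(3) by simp
    then show "oseg x 0 (deg \<Lambda> \<mu>) = \<mu>"
      using initial_eq[OF _ initial_refl] initialD(2) x(3)[OF le] k'(3) by metis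
  qed
qed

end

declare plus_fun_apply [simp del]

section \<open>Prepending a finite path\<close>

context k_graph
begin

text \<open>Replaces the definite description in \<open>prepend\<close> by a condition on initial
  segments of degree at least d(\<alpha>); all others are truncations of these.\<close>

lemma prepend_eqI:
  assumes x: "x \<in> omega_morphisms \<Lambda>" and a: "\<alpha> \<in> paths \<Lambda>" "src \<Lambda> \<alpha> = orng x"
    and y: "y \<in> omega_morphisms \<Lambda>" "odeg y = odeg x + ext (deg \<Lambda> \<alpha>)"
    and seg: "\<And>q. ext q \<le> odeg x \<Longrightarrow> oseg y 0 (deg \<Lambda> \<alpha> + q) = \<alpha> \<cdot> oseg x 0 q"
  shows "prepend \<Lambda> \<alpha> x = y"
proof -
  let ?d = "deg \<Lambda> \<alpha>"
  have dle: "ext ?d \<le> odeg y" unfolding y(2) by (simp add: le_fun_def plus_fun_apply)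
  have sub: "odeg y - ext ?d = odeg x"
  proof
    fix i
    show "(odeg y - ext ?d) i = odeg x i" unfolding y(2) by (cases "odeg x i") (simp_all add: plus_fun_apply)
  qed
  have le: "ext (?d + q) \<le> odeg y \<longleftrightarrow> ext q \<le> odeg x" for q
    using ext_le_diff_iff[OF dle] unfolding sub by blast
  have head: "oseg y 0 ?d = \<alpha>"
    using seg[of 0, OF ext_zero_le] comp_src[OF a(1)] a(2) by simp
  have tail: "oseg y ?d (?d + q) = oseg x 0 q" if "ext q \<le> odeg x" for q
  proof -
    note dq = le[of q, THEN iffD2, OF that]
    have e: "\<alpha> \<cdot> oseg y ?d (?d + q) = \<alpha> \<cdot> oseg x 0 q"
      using oseg_comp[OF y(1) zero_le_fun fun_le_add dq] unfolding head seg[OF that] .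
    have "src \<Lambda> \<alpha> = rng \<Lambda> (oseg y ?d (?d + q))"
      using omegaD(4)[OF y(1) zero_le_fun dle] omegaD(3)[OF y(1) fun_le_add dq] head by simp
    moreover have "src \<Lambda> \<alpha> = rng \<Lambda> (oseg x 0 q)"
      using omegaD(3)[OF x zero_le_fun that] a by simp
    ultimately show ?thesis
      using comp_cancel_left[OF a(1) omegaD(1)[OF y(1) fun_le_add dq] _ omegaD(1)[OF x zero_le_fun that] _ e]
      by blast
  qed
  have sh: "shift ?d y = x"
  proof (rule omega_eqI)
    fix q assume "ext q \<le> odeg (shift ?d y)"
    then have q: "ext q \<le> odeg x" using sub by simp
    then show "oseg (shift ?d y) 0 q = oseg x 0 q"
      using oseg_shift[of 0 q ?d y] le[of q] tail by simp
  qed (use shift_in_omega[OF y(1) dle] x sub in simp_all)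
  show ?thesis
    unfolding prepend_def
  proof (rule the_equality)
    fix z assume z: "z \<in> omega_morphisms \<Lambda> \<and> odeg z = odeg x + ext ?d \<and> oseg z 0 ?d = \<alpha> \<and> shift ?d z = x"
    then have zd: "odeg z = odeg y" using y by simp
    have zseg: "oseg z 0 (?d + q) = oseg y 0 (?d + q)" if "ext q \<le> odeg x" for q
      using oseg_comp[of z 0 ?d "?d + q"] oseg_shift[of 0 q ?d z] z le[of q] that zd seg[OF that] by simp
    show "z = y"
    proof (rule omega_eqI)
      fix q assume q: "ext q \<le> odeg z"
      \<comment> \<open>q need not lie above d(\<alpha>), so the comparison takes place at
        \<open>sup q ?d\<close> and is then truncated to q.\<close>
      define r where "r = sup q ?d - ?d"
      have r: "sup q ?d = ?d + r" by (auto simp: r_def fun_eq_iff sup_nat_def plus_fun_apply)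
      have "ext (sup q ?d) \<le> odeg y" using q dle zd ext_sup_le by metis
      then have rl: "ext r \<le> odeg x" using le[of r] unfolding r by blast
      then have e: "oseg z 0 (sup q ?d) = oseg y 0 (sup q ?d)" unfolding r by (rule zseg)
      have "oseg z 0 q \<preceq> oseg y 0 (sup q ?d)"
        unfolding e[symmetric]
        by (rule oseg_initial) (use z \<open>ext (sup q ?d) \<le> odeg y\<close> zd in auto)
      then have "oseg y 0 (deg \<Lambda> (oseg z 0 q)) = oseg z 0 q"
        using initial_oseg_eq[OF y(1) \<open>ext (sup q ?d) \<le> odeg y\<close>] by blast
      then show "oseg z 0 q = oseg y 0 q"
        using omegaD(2)[of z 0 q] z q by simp
    qed (use z y zd in auto)
  qed (use y head sh in blast)
qed

text \<open>Existence: the paths \<alpha>x(0,q) form a directed family, and its limit satisfies the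
  description of \<alpha>x.\<close>

lemma prepend_props:
  assumes x: "x \<in> omega_morphisms \<Lambda>" and a: "\<alpha> \<in> paths \<Lambda>" "src \<Lambda> \<alpha> = orng x"
  shows "prepend \<Lambda> \<alpha> x \<in> omega_morphisms \<Lambda>" "odeg (prepend \<Lambda> \<alpha> x) = odeg x + ext (deg \<Lambda> \<alpha>)"
    "\<And>q. ext q \<le> odeg x \<Longrightarrow> oseg (prepend \<Lambda> \<alpha> x) 0 (deg \<Lambda> \<alpha> + q) = \<alpha> \<cdot> oseg x 0 q"
proof -
  let ?d = "deg \<Lambda> \<alpha>"
  let ?M = "odeg x + ext ?d"
  define F where "F = {\<alpha> \<cdot> oseg x 0 q |q. ext q \<le> odeg x}"
  have F: "\<alpha> \<cdot> oseg x 0 q \<in> paths \<Lambda>" "deg \<Lambda> (\<alpha> \<cdot> oseg x 0 q) = ?d + q" "src \<Lambda> \<alpha> = rng \<Lambda> (oseg x 0 q)"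
    if "ext q \<le> odeg x" for q
    using omegaD[OF x zero_le_fun that] a by (simp_all add: comp_closed deg_comp)
  have "\<exists>y \<in> omega_morphisms \<Lambda>. odeg y = ?M \<and>
    (\<forall>\<kappa>\<in>F. \<forall>\<mu>. \<mu> \<preceq> \<kappa> \<longrightarrow> ext (deg \<Lambda> \<mu>) \<le> ?M \<longrightarrow> oseg y 0 (deg \<Lambda> \<mu>) = \<mu>)"
  proof (rule directed_limit[of ?M F])
    fix q assume q: "ext q \<le> ?M"
    \<comment> \<open>Truncated subtraction is intended: d(\<alpha>) + (q - d(\<alpha>)) is the join
      of q and d(\<alpha>), hence above q.\<close>
    have "enat (q i - ?d i) \<le> odeg x i" for i
      using le_funD[OF q, of i] by (cases "odeg x i") (auto simp: plus_fun_apply)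
    then have "ext (q - ?d) \<le> odeg x" by (simp add: le_fun_def)
    then have "\<alpha> \<cdot> oseg x 0 (q - ?d) \<in> F" "deg \<Lambda> (\<alpha> \<cdot> oseg x 0 (q - ?d)) = ?d + (q - ?d)"
      using F(2)[of "q - ?d"] by (auto simp only: F_def)
    moreover have "q \<le> ?d + (q - ?d)" by (auto simp: le_fun_def plus_fun_apply)
    ultimately show "\<exists>\<kappa>\<in>F. q \<le> deg \<Lambda> \<kappa>" by metis
  next
    show "F \<subseteq> paths \<Lambda>" using F(1) by (auto simp: F_def)
  next
    fix \<mu> \<nu> assume "\<mu> \<in> F" "\<nu> \<in> F"
    then obtain p q where pq: "ext p \<le> odeg x" "ext q \<le> odeg x" "\<mu> = \<alpha> \<cdot> oseg x 0 p" "\<nu> = \<alpha> \<cdot> oseg x 0 q"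
      by (auto simp: F_def)
    have s: "ext (sup p q) \<le> odeg x" using pq ext_sup_le by blast
    have "\<mu> \<preceq> \<alpha> \<cdot> oseg x 0 (sup p q)" "\<nu> \<preceq> \<alpha> \<cdot> oseg x 0 (sup p q)"
      unfolding pq(3,4)
      using initial_comp_left[OF oseg_initial[OF x sup_ge1 s] a(1) F(3)[OF pq(1)]]
        initial_comp_left[OF oseg_initial[OF x sup_ge2 s] a(1) F(3)[OF pq(2)]] by (simp_all del: sup_apply)
    then show "\<exists>\<kappa>. \<mu> \<preceq> \<kappa> \<and> \<nu> \<preceq> \<kappa>" by blast
  qed
  then obtain y where y: "y \<in> omega_morphisms \<Lambda>" "odeg y = ?M"
    "\<And>\<mu> \<kappa>. \<kappa> \<in> F \<Longrightarrow> \<mu> \<preceq> \<kappa> \<Longrightarrow> ext (deg \<Lambda> \<mu>) \<le> ?M \<Longrightarrow> oseg y 0 (deg \<Lambda> \<mu>) = \<mu>"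
    by blast
  have "oseg y 0 (?d + q) = \<alpha> \<cdot> oseg x 0 q" if q: "ext q \<le> odeg x" for q
  proof -
    have "ext (?d + q) \<le> ?M" using q by (simp add: le_fun_def add.commute add_right_mono plus_fun_apply flip: plus_enat_simps)
    then show ?thesis
      using y(3)[of "\<alpha> \<cdot> oseg x 0 q" "\<alpha> \<cdot> oseg x 0 q"] F[OF q] initial_refl q
      by (auto simp: F_def)
  qed
  moreover from this have "prepend \<Lambda> \<alpha> x = y"
    using prepend_eqI[OF x a y(1,2)] by blast
  ultimately show "prepend \<Lambda> \<alpha> x \<in> omega_morphisms \<Lambda>" "odeg (prepend \<Lambda> \<alpha> x) = odeg x + ext (deg \<Lambda> \<alpha>)"
    "\<And>q. ext q \<le> odeg x \<Longrightarrow> oseg (prepend \<Lambda> \<alpha> x) 0 (deg \<Lambda> \<alpha> + q) = \<alpha> \<cdot> oseg x 0 q"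
    using y by auto
qed

section \<open>Generic paths\<close>

text \<open>Lets one generic construction serve (A), which asks for a boundary path, and makes the
  boundary path argument available against (B).\<close>

lemma le_infinity_subset_boundary: "le_infinity_paths \<Lambda> \<subseteq> boundary_paths \<Lambda>"
proof
  fix x assume "x \<in> le_infinity_paths \<Lambda>"
  then obtain n\<^sub>x where x: "x \<in> omega_morphisms \<Lambda>" and nx: "ext n\<^sub>x \<le> odeg x"
    and no_edge: "\<And>n i. n\<^sub>x \<le> n \<Longrightarrow> ext n \<le> odeg x \<Longrightarrow> enat (n i) = odeg x i \<Longrightarrow>
       at_vertex \<Lambda> (overt x n) (paths_deg \<Lambda> (gen i)) = {}"
    unfolding le_infinity_paths_def by blast
  have "\<exists>p. ext p \<le> odeg x - ext n \<and> oseg x n (n + p) \<in> E"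
    if n: "ext n \<le> odeg x" and E: "E \<in> FE \<Lambda> (overt x n)" for n E
  proof -
    from E have fin: "finite E" and ex: "exhaustive \<Lambda> (overt x n) E" by (auto simp: FE_def)
    \<comment> \<open>\<open>x(n,N)\<close> is so long that a minimal common extension with a member of \<open>E\<close> could only be
      longer in a finite direction of \<open>x\<close>, where \<open>x(N)\<close> admits no edge\<close>
    define N where "N i = (case odeg x i of enat c \<Rightarrow> c
      | \<infinity> \<Rightarrow> max (n i) (max (n\<^sub>x i) (Max ((\<lambda>e. n i + deg \<Lambda> e i) ` E))))" for i
    have nN: "n \<le> N" "n\<^sub>x \<le> N" and N: "ext N \<le> odeg x"
      using n nx by (auto simp: N_def le_fun_def split: enat.split) (metis enat_ord_simps(1))+
    let ?\<mu> = "oseg x n N"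
    have mu: "?\<mu> \<in> paths \<Lambda>" "deg \<Lambda> ?\<mu> = N - n" "rng \<Lambda> ?\<mu> = overt x n" "src \<Lambda> ?\<mu> = overt x N"
      using omegaD[OF x nN(1) N] .
    then have "?\<mu> \<in> at_vertex \<Lambda> (overt x n) (paths \<Lambda>)" by (simp add: at_vertex_def)
    then obtain e where e: "e \<in> E" "MCE \<Lambda> ?\<mu> e \<noteq> {}"
      using ex unfolding exhaustive_def by blast
    then have e': "e \<in> paths \<Lambda>" "rng \<Lambda> e = overt x n"
      using ex by (auto simp: exhaustive_def at_vertex_def)
    obtain \<kappa> where k: "deg \<Lambda> \<kappa> = sup (deg \<Lambda> ?\<mu>) (deg \<Lambda> e)" "?\<mu> \<preceq> \<kappa>" "e \<preceq> \<kappa>"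
      using e(2) MCE_iff[OF mu(1) e'(1)] by blast
    obtain \<tau> where t: "\<tau> \<in> paths \<Lambda>" "src \<Lambda> ?\<mu> = rng \<Lambda> \<tau>" "\<kappa> = ?\<mu> \<cdot> \<tau>"
      using k(2) by (rule initialE)
    \<comment> \<open>Once \<tau> is known to be a vertex, \<kappa> is x(n,N) itself, and e becomes
      a prefix of x(n,N), that is, a segment of x starting at n.\<close>
    have "deg \<Lambda> \<tau> i = 0" for i
    proof (cases "odeg x i")
      case infinity
      have "n i + deg \<Lambda> e i \<le> N i"
        using fin e(1) infinity by (simp add: N_def) (meson Max_ge finite_imageI imageI le_max_iff_disj)
      moreover have "n i \<le> N i" using nN by (simp add: le_fun_def)
      ultimately have "deg \<Lambda> e i \<le> deg \<Lambda> ?\<mu> i" by (simp add: mu(2))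
      then have "deg \<Lambda> \<kappa> i = deg \<Lambda> ?\<mu> i" by (simp add: k(1) sup_nat_def)
      moreover have "deg \<Lambda> \<kappa> i = deg \<Lambda> ?\<mu> i + deg \<Lambda> \<tau> i"
        using deg_comp[OF mu(1) t(1,2)] t(3) by (simp add: plus_fun_apply)
      ultimately show ?thesis by simp
    next
      case (enat c)
      then have empty: "at_vertex \<Lambda> (overt x N) (paths_deg \<Lambda> (gen i)) = {}"
        by (intro no_edge nN N) (simp add: N_def)
      show ?thesis
      proof (rule ccontr)
        assume "deg \<Lambda> \<tau> i \<noteq> 0"
        then have "gen i \<le> deg \<Lambda> \<tau>" by (auto simp: gen_def le_fun_def)
        with t(1) obtain f where f: "f \<preceq> \<tau>" "deg \<Lambda> f = gen i" by (rule initial_exists)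
        have "f \<in> at_vertex \<Lambda> (overt x N) (paths_deg \<Lambda> (gen i))"
          using initialD[OF f(1)] f(2) t(2) mu(4) by (simp add: at_vertex_def paths_deg_def)
        with empty show False by blast
      qed
    qed
    then have t0: "deg \<Lambda> \<tau> = 0" by (simp add: fun_eq_iff)
    have "\<kappa> = ?\<mu>"
      using deg_zero_eq_rng(1)[OF t(1) t0] t(2,3) comp_src[OF mu(1)] by simp
    then have e\<mu>: "e \<preceq> ?\<mu>" using k(3) by simp
    let ?p = "deg \<Lambda> e"
    have pN: "n + ?p \<le> N"
    proof (rule le_funI)
      fix i
      show "(n + ?p) i \<le> N i"
        using le_funD[OF initialD(4)[OF e\<mu>], of i] le_funD[OF nN(1), of i] mu(2)
        by (simp add: plus_fun_apply)
    qed
    have np: "ext (n + ?p) \<le> odeg x" by (rule ext_mono_le[OF pN N])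
    have "oseg x n (n + ?p) \<preceq> ?\<mu>"
      using initial_compI[OF omegaD(1)[OF x fun_le_add np] omegaD(1)[OF x pN N]]
        oseg_comp[OF x fun_le_add pN N] omegaD(4)[OF x fun_le_add np] omegaD(3)[OF x pN N] by simp
    moreover have "deg \<Lambda> (oseg x n (n + ?p)) = ?p"
      using omegaD(2)[OF x fun_le_add np] by simp
    ultimately have "oseg x n (n + ?p) = e" using initial_eq e\<mu> by blast
    moreover have "ext ?p \<le> odeg x - ext n" using ext_le_diff_iff[OF n] np by blast
    ultimately show ?thesis using e(1) by (intro exI[of _ ?p] conjI) simp_all
  qed
  with x show "x \<in> boundary_paths \<Lambda>" by (simp add: boundary_paths_def)
qed

text \<open>A path meeting this for every N either has infinite degree in direction i or passes a
  vertex without edges in that direction.\<close>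

definition tall_or_dead :: "'k \<Rightarrow> nat \<Rightarrow> 'a set" where
  "tall_or_dead i N = {\<mu> \<in> paths \<Lambda>. N \<le> deg \<Lambda> \<mu> i \<or> dead i \<mu>}"

text \<open>Append edges of degree \<open>gen i\<close> one at a time until N is reached or none is
  available.\<close>

lemma tall_or_dead_dense:
  assumes "\<mu> \<in> paths \<Lambda>"
  shows "\<exists>\<kappa> \<in> tall_or_dead i N. \<mu> \<preceq> \<kappa>"
proof (induction N)
  case 0
  show ?case using assms initial_refl by (auto simp: tall_or_dead_def)
next
  case (Suc N)
  then obtain \<kappa> where k: "\<kappa> \<in> paths \<Lambda>" "\<mu> \<preceq> \<kappa>" "N \<le> deg \<Lambda> \<kappa> i \<or> dead i \<kappa>"
    by (auto simp: tall_or_dead_def)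
  show ?case
  proof (cases "dead i \<kappa>")
    case True
    with k show ?thesis by (auto simp: tall_or_dead_def)
  next
    case False
    then obtain f where f: "f \<in> paths \<Lambda>" "src \<Lambda> \<kappa> = rng \<Lambda> f" "deg \<Lambda> f = gen i"
      by (auto simp: dead_def at_vertex_def paths_deg_def)
    have "Suc N \<le> deg \<Lambda> (\<kappa> \<cdot> f) i"
      using k False f by (simp add: deg_comp gen_def plus_fun_apply)
    then have "\<kappa> \<cdot> f \<in> tall_or_dead i (Suc N)"
      using comp_closed[OF k(1) f(1,2)] by (simp add: tall_or_dead_def)
    moreover have "\<mu> \<preceq> \<kappa> \<cdot> f" using k(2) initial_compI[OF k(1) f(1,2)] by (rule initial_trans)
    ultimately show ?thesis by blast
  qed
qed

lemma chain_limit: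
  assumes chain: "\<And>j. \<xi> j \<preceq> \<xi> (Suc j)"
  shows "\<exists>x \<in> omega_morphisms \<Lambda>. (\<forall>i. odeg x i = (SUP j. enat (deg \<Lambda> (\<xi> j) i))) \<and>
    (\<forall>j. ext (deg \<Lambda> (\<xi> j)) \<le> odeg x \<and> oseg x 0 (deg \<Lambda> (\<xi> j)) = \<xi> j)"
proof -
  define M where "M i = (SUP j. enat (deg \<Lambda> (\<xi> j) i))" for i
  have paths: "\<xi> j \<in> paths \<Lambda>" for j using initialD(1)[OF chain] .
  have mono: "\<xi> j \<preceq> \<xi> l" if "j \<le> l" for j l
    using that by (induction l rule: dec_induct) (use paths initial_refl initial_trans chain in blast)+
  have le: "ext (deg \<Lambda> (\<xi> j)) \<le> M" for j by (auto simp: M_def le_fun_def intro: SUP_upper)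
  have "\<exists>x \<in> omega_morphisms \<Lambda>. odeg x = M \<and>
    (\<forall>\<kappa>\<in>range \<xi>. \<forall>\<mu>. \<mu> \<preceq> \<kappa> \<longrightarrow> ext (deg \<Lambda> \<mu>) \<le> M \<longrightarrow> oseg x 0 (deg \<Lambda> \<mu>) = \<mu>)"
  proof (rule directed_limit)
    fix q assume q: "ext q \<le> M"
    have "\<exists>j. q i \<le> deg \<Lambda> (\<xi> j) i" for i
    \<comment> \<open>If no member of the chain reached q in coordinate i, the supremum would be at
      most \<open>q i - 1\<close>, which is smaller than \<open>q i\<close>.\<close>
    proof (rule ccontr)
      assume "\<nexists>j. q i \<le> deg \<Lambda> (\<xi> j) i"
      then have lt: "deg \<Lambda> (\<xi> j) i < q i" for j by (simp add: not_le)
      have "enat (deg \<Lambda> (\<xi> j) i) \<le> enat (q i - 1)" for j using lt[of j] by simp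
      then have "M i \<le> enat (q i - 1)" unfolding M_def by (rule SUP_least)
      moreover have "0 < q i" using lt[of 0] by simp
      ultimately show False using le_funD[OF q, of i] by (cases "M i") auto
    qed
    then obtain J where J: "\<And>i. q i \<le> deg \<Lambda> (\<xi> (J i)) i" by metis
    \<comment> \<open>There are finitely many directions, so one stage of the chain suffices for all
      of them.\<close>
    define j where "j = Max (range J)"
    have "q i \<le> deg \<Lambda> (\<xi> j) i" for i
    proof -
      have "J i \<le> j" unfolding j_def by (intro Max_ge) auto
      then show ?thesis using J[of i] initialD(4)[OF mono] by (meson le_funD order_trans)
    qed
    then show "\<exists>\<kappa>\<in>range \<xi>. q \<le> deg \<Lambda> \<kappa>" by (auto simp: le_fun_def)
  next
    show "range \<xi> \<subseteq> paths \<Lambda>" using paths by blast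
  next
    fix \<mu> \<nu> assume "\<mu> \<in> range \<xi>" "\<nu> \<in> range \<xi>"
    then obtain j l where "\<mu> = \<xi> j" "\<nu> = \<xi> l" by blast
    then have "\<mu> \<preceq> \<xi> (max j l) \<and> \<nu> \<preceq> \<xi> (max j l)" using mono by simp
    then show "\<exists>\<kappa>. \<mu> \<preceq> \<kappa> \<and> \<nu> \<preceq> \<kappa>" by blast
  qed
  then obtain x where "x \<in> omega_morphisms \<Lambda>" "odeg x = M"
    "\<forall>\<kappa>\<in>range \<xi>. \<forall>\<mu>. \<mu> \<preceq> \<kappa> \<longrightarrow> ext (deg \<Lambda> \<mu>) \<le> M \<longrightarrow> oseg x 0 (deg \<Lambda> \<mu>) = \<mu>" by blast
  then show ?thesis using le initial_refl[OF paths] M_def by (intro bexI[of _ x]) auto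
qed

text \<open>The Baire argument: enumerate the requirements and extend the path at stage j so as to
  meet the j-th. Extending a path that meets a requirement may destroy it, so the conclusion speaks
  of some initial segment only.\<close>

lemma generic_path:
  assumes v: "v \<in> verts \<Lambda>" and count: "countable \<P>"
    and dense: "\<And>P \<mu>. P \<in> \<P> \<Longrightarrow> \<mu> \<in> paths \<Lambda> \<Longrightarrow> rng \<Lambda> \<mu> = v \<Longrightarrow> \<exists>\<kappa>\<in>P. \<mu> \<preceq> \<kappa>"
  shows "\<exists>x \<in> le_infinity_paths \<Lambda>. orng x = v \<and> (\<forall>P\<in>\<P>. \<exists>n. ext n \<le> odeg x \<and> oseg x 0 n \<in> P)"
proof -
  \<comment> \<open>The additional requirements, still countably many, force the limit into
    \<open>\<Lambda>\<^sup>\<le>\<^sup>\<infinity>\<close>.\<close>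
  define \<Q> where "\<Q> = \<P> \<union> range (\<lambda>(i, N). tall_or_dead i N)"
  have Qc: "countable \<Q>" "\<Q> \<noteq> {}" using count by (auto simp: \<Q>_def)
  define Q where "Q = from_nat_into \<Q>"
  have Qr: "range Q = \<Q>" unfolding Q_def by (rule range_from_nat_into[OF Qc(2,1)])
  have Qdense: "\<exists>\<kappa>\<in>Q j. \<mu> \<preceq> \<kappa>" if m: "\<mu> \<in> paths \<Lambda>" "rng \<Lambda> \<mu> = v" for j \<mu>
  proof -
    have "Q j \<in> \<Q>" using Qr by blast
    then consider "Q j \<in> \<P>" | i N where "Q j = tall_or_dead i N" by (auto simp: \<Q>_def)
    then show ?thesis
    proof cases
      case 1
      then show ?thesis using m dense by blast
    next
      case 2
      then show ?thesis using tall_or_dead_dense[OF m(1)] by simp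
    qed
  qed
  \<comment> \<open>The clause for \<open>j = 0\<close> fixes the start of the chain; beyond that it
    says nothing.\<close>
  have "\<exists>\<xi>. \<forall>j. ((\<xi> j \<in> paths \<Lambda> \<and> rng \<Lambda> (\<xi> j) = v) \<and> (j = 0 \<longrightarrow> \<xi> j = v)) \<and>
    (\<xi> j \<preceq> \<xi> (Suc j) \<and> \<xi> (Suc j) \<in> Q j)"
  proof (rule dependent_nat_choice)
    show "\<exists>\<mu>. (\<mu> \<in> paths \<Lambda> \<and> rng \<Lambda> \<mu> = v) \<and> (0 = (0::nat) \<longrightarrow> \<mu> = v)" using vertsD[OF v] by blast
  next
    fix \<mu> and j :: nat
    assume m: "(\<mu> \<in> paths \<Lambda> \<and> rng \<Lambda> \<mu> = v) \<and> (j = 0 \<longrightarrow> \<mu> = v)"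
    then obtain \<kappa> where "\<kappa> \<in> Q j" "\<mu> \<preceq> \<kappa>" using Qdense by blast
    then show "\<exists>\<kappa>. ((\<kappa> \<in> paths \<Lambda> \<and> rng \<Lambda> \<kappa> = v) \<and> (Suc j = 0 \<longrightarrow> \<kappa> = v)) \<and> (\<mu> \<preceq> \<kappa> \<and> \<kappa> \<in> Q j)"
      using initialD[of \<mu> \<kappa>] m by auto
  qed
  then obtain \<xi> where xi0: "\<xi> 0 = v" and chain: "\<And>j. \<xi> j \<preceq> \<xi> (Suc j)" and xiQ: "\<And>j. \<xi> (Suc j) \<in> Q j"
    by blast
  obtain x where x: "x \<in> omega_morphisms \<Lambda>" "\<And>i. odeg x i = (SUP j. enat (deg \<Lambda> (\<xi> j) i))"
    "\<And>j. ext (deg \<Lambda> (\<xi> j)) \<le> odeg x" "\<And>j. oseg x 0 (deg \<Lambda> (\<xi> j)) = \<xi> j"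
    using chain_limit[of \<xi>] chain by blast
  have mono: "\<xi> j \<preceq> \<xi> l" if "j \<le> l" for j l
    using that by (induction l rule: dec_induct) (use initialD(1)[OF chain] initial_refl initial_trans chain in blast)+
  have meets: "\<exists>j. \<xi> j \<in> P" if "P \<in> \<Q>" for P
    using that xiQ Qr by blast
  \<comment> \<open>If d(x) equals c in direction i, no initial segment is \<open>Suc c\<close> long
    there, so that requirement can only have been met by a dead end.\<close>
  have "\<exists>j. odeg x i = \<infinity> \<or> dead i (\<xi> j)" for i
  proof (cases "odeg x i")
    case (enat c)
    have "tall_or_dead i (Suc c) \<in> \<Q>" unfolding \<Q>_def by auto
    then obtain j where "\<xi> j \<in> tall_or_dead i (Suc c)" using meets by blast
    moreover have "deg \<Lambda> (\<xi> j) i \<le> c" using le_funD[OF x(3)[of j], of i] enat by simp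
    ultimately show ?thesis by (auto simp: tall_or_dead_def)
  qed simp
  then obtain J where J: "\<And>i. odeg x i = \<infinity> \<or> dead i (\<xi> (J i))" by metis
  \<comment> \<open>A common stage for all directions; its degree is the bound
    \<open>n\<^sub>x\<close> in the definition of
    \<open>\<Lambda>\<^sup>\<le>\<^sup>\<infinity>\<close>.\<close>
  define j where "j = Max (range J)"
  have jd: "odeg x i = \<infinity> \<or> dead i (\<xi> j)" for i
  proof -
    have "J i \<le> j" unfolding j_def by (intro Max_ge) auto
    then show ?thesis using J[of i] dead_mono[OF _ mono] by blast
  qed
  have "at_vertex \<Lambda> (overt x n) (paths_deg \<Lambda> (gen i)) = {}"
    if n: "deg \<Lambda> (\<xi> j) \<le> n" "ext n \<le> odeg x" "enat (n i) = odeg x i" for n i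
  proof -
    have "dead i (\<xi> j)" using jd[of i] n(3) by auto
    moreover have "\<xi> j \<preceq> oseg x 0 n" using oseg_initial[OF x(1) n(1,2)] x(4) by simp
    ultimately have "dead i (oseg x 0 n)" by (rule dead_mono)
    then show ?thesis using omegaD(4)[OF x(1) zero_le_fun n(2)] by (simp add: dead_def)
  qed
  then have "x \<in> le_infinity_paths \<Lambda>"
    unfolding le_infinity_paths_def using x(1,3) by blast
  moreover have "orng x = v" using x(4)[of 0] vertsD(2)[OF v] xi0 by simp
  moreover have "\<exists>n. ext n \<le> odeg x \<and> oseg x 0 n \<in> P" if P: "P \<in> \<P>" for P
  proof -
    have "P \<in> \<Q>" using P by (simp add: \<Q>_def)
    then obtain j where "\<xi> j \<in> P" using meets by blast
    then show ?thesis using x(3,4)[of j] by auto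
  qed
  ultimately show ?thesis by blast
qed

section \<open>Aperiodicity\<close>

lemma aperiodic_iff:
  "aperiodic \<Lambda> \<longleftrightarrow> (\<forall>\<alpha> \<in> paths \<Lambda>. \<forall>\<beta> \<in> paths \<Lambda>. \<alpha> \<noteq> \<beta> \<and> src \<Lambda> \<alpha> = src \<Lambda> \<beta> \<longrightarrow>
     (\<exists>\<tau> \<in> paths \<Lambda>. rng \<Lambda> \<tau> = src \<Lambda> \<alpha> \<and> \<not> (\<exists>\<kappa>. \<alpha> \<cdot> \<tau> \<preceq> \<kappa> \<and> \<beta> \<cdot> \<tau> \<preceq> \<kappa>)))"
proof -
  have eq: "(\<exists>\<tau> \<in> at_vertex \<Lambda> (src \<Lambda> \<alpha>) (paths \<Lambda>). MCE \<Lambda> (\<alpha> \<cdot> \<tau>) (\<beta> \<cdot> \<tau>) = {}) \<longleftrightarrow>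
      (\<exists>\<tau> \<in> paths \<Lambda>. rng \<Lambda> \<tau> = src \<Lambda> \<alpha> \<and> \<not> (\<exists>\<kappa>. \<alpha> \<cdot> \<tau> \<preceq> \<kappa> \<and> \<beta> \<cdot> \<tau> \<preceq> \<kappa>))"
    if "\<alpha> \<in> paths \<Lambda>" "\<beta> \<in> paths \<Lambda>" "src \<Lambda> \<alpha> = src \<Lambda> \<beta>" for \<alpha> \<beta>
  proof -
    have "MCE \<Lambda> (\<alpha> \<cdot> \<tau>) (\<beta> \<cdot> \<tau>) = {} \<longleftrightarrow> \<not> (\<exists>\<kappa>. \<alpha> \<cdot> \<tau> \<preceq> \<kappa> \<and> \<beta> \<cdot> \<tau> \<preceq> \<kappa>)"
      if "\<tau> \<in> paths \<Lambda>" "rng \<Lambda> \<tau> = src \<Lambda> \<alpha>" for \<tau>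
      using MCE_nonempty_iff[of "\<alpha> \<cdot> \<tau>" "\<beta> \<cdot> \<tau>"] that \<open>\<alpha> \<in> paths \<Lambda>\<close> \<open>\<beta> \<in> paths \<Lambda>\<close>
        \<open>src \<Lambda> \<alpha> = src \<Lambda> \<beta>\<close> comp_closed by metis
    then show ?thesis unfolding at_vertex_def by blast
  qed
  show ?thesis unfolding aperiodic_def
    by (intro ball_cong refl imp_cong eq) auto
qed

text \<open>A boundary path must run through a member of the exhaustive set E at N. All members of E
  have degree m, so it does so exactly between N and N + m.\<close>

lemma periodic_pair_boundary_path:
  assumes fa: "finitely_aligned \<Lambda>"
    and a: "\<alpha> \<in> paths \<Lambda>" and b: "\<beta> \<in> paths \<Lambda>" and s: "src \<Lambda> \<alpha> = src \<Lambda> \<beta>"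
    and periodic: "\<And>\<tau>. \<tau> \<in> paths \<Lambda> \<Longrightarrow> rng \<Lambda> \<tau> = src \<Lambda> \<alpha> \<Longrightarrow> \<exists>\<kappa>. \<alpha> \<cdot> \<tau> \<preceq> \<kappa> \<and> \<beta> \<cdot> \<tau> \<preceq> \<kappa>"
    and x: "x \<in> boundary_paths \<Lambda>" "orng x = src \<Lambda> \<alpha>"
    and m: "sup (deg \<Lambda> \<alpha>) (deg \<Lambda> \<beta>) = deg \<Lambda> \<alpha> + m"
    and N: "ext N \<le> odeg x"
  shows "ext (N + m) \<le> odeg x" "\<beta> \<cdot> oseg x 0 N \<preceq> \<alpha> \<cdot> oseg x 0 (N + m)"
proof -
  have xo: "x \<in> omega_morphisms \<Lambda>" using x by (simp add: boundary_paths_def)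
  define \<mu> where "\<mu> = oseg x 0 N"
  have mu: "\<mu> \<in> paths \<Lambda>" "deg \<Lambda> \<mu> = N" "rng \<Lambda> \<mu> = src \<Lambda> \<alpha>" "src \<Lambda> \<mu> = overt x N"
    using omegaD[OF xo zero_le_fun N] x(2) by (simp_all add: \<mu>_def)
  have am: "\<alpha> \<cdot> \<mu> \<in> paths \<Lambda>" "deg \<Lambda> (\<alpha> \<cdot> \<mu>) = deg \<Lambda> \<alpha> + N" "src \<Lambda> (\<alpha> \<cdot> \<mu>) = overt x N"
    using a mu by (simp_all add: comp_closed deg_comp src_comp)
  have bm: "\<beta> \<cdot> \<mu> \<in> paths \<Lambda>" "deg \<Lambda> (\<beta> \<cdot> \<mu>) = deg \<Lambda> \<beta> + N" "src \<Lambda> (\<beta> \<cdot> \<mu>) = overt x N"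
    using b s mu by (simp_all add: comp_closed deg_comp src_comp)
  define E where "E = {\<nu> \<in> paths \<Lambda>. rng \<Lambda> \<nu> = overt x N \<and> \<alpha> \<cdot> \<mu> \<cdot> \<nu> \<in> MCE \<Lambda> (\<alpha> \<cdot> \<mu>) (\<beta> \<cdot> \<mu>)}"
  \<comment> \<open>By left cancellation E embeds into a set of minimal common extensions, which
    finite alignment makes finite.\<close>
  have "inj_on (\<lambda>\<nu>. \<alpha> \<cdot> \<mu> \<cdot> \<nu>) E"
    using comp_cancel_left[OF am(1)] am(3) by (auto simp: E_def inj_on_def)
  moreover have "(\<lambda>\<nu>. \<alpha> \<cdot> \<mu> \<cdot> \<nu>) ` E \<subseteq> MCE \<Lambda> (\<alpha> \<cdot> \<mu>) (\<beta> \<cdot> \<mu>)" by (auto simp: E_def)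
  moreover have "finite (MCE \<Lambda> (\<alpha> \<cdot> \<mu>) (\<beta> \<cdot> \<mu>))"
    using fa am(1) bm(1) unfolding finitely_aligned_def by blast
  ultimately have "finite E" by (rule inj_on_finite)
  \<comment> \<open>Exhaustiveness: a common extension \<kappa> of \<alpha>\<mu>\<tau> and
    \<beta>\<mu>\<tau> also extends \<alpha>\<mu> and \<beta>\<mu>, hence some \<alpha>\<mu>\<nu>
    with \<nu> in E. Stripping \<alpha>\<mu> from \<kappa> leaves a common extension of \<nu> and
    \<tau>.\<close>
  moreover have "\<exists>\<nu>\<in>E. MCE \<Lambda> \<tau> \<nu> \<noteq> {}" if t: "\<tau> \<in> at_vertex \<Lambda> (overt x N) (paths \<Lambda>)" for \<tau>
  proof -
    have t': "\<tau> \<in> paths \<Lambda>" "rng \<Lambda> \<tau> = overt x N" using t by (simp_all add: at_vertex_def)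
    have mt: "\<mu> \<cdot> \<tau> \<in> paths \<Lambda>" "rng \<Lambda> (\<mu> \<cdot> \<tau>) = src \<Lambda> \<alpha>" "\<mu> \<preceq> \<mu> \<cdot> \<tau>"
      using mu t' by (simp_all add: comp_closed rng_comp initial_compI)
    obtain \<kappa> where k: "\<alpha> \<cdot> (\<mu> \<cdot> \<tau>) \<preceq> \<kappa>" "\<beta> \<cdot> (\<mu> \<cdot> \<tau>) \<preceq> \<kappa>" using periodic[OF mt(1,2)] by blast
    have amk: "\<alpha> \<cdot> \<mu> \<preceq> \<kappa>" "\<beta> \<cdot> \<mu> \<preceq> \<kappa>"
      using initial_comp_left[OF mt(3)] a b s mu(3) k initial_trans by metis+
    obtain \<theta> where th: "\<theta> \<in> MCE \<Lambda> (\<alpha> \<cdot> \<mu>) (\<beta> \<cdot> \<mu>)" "\<theta> \<preceq> \<kappa>" using amk by (rule MCE_below)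
    then have "\<alpha> \<cdot> \<mu> \<preceq> \<theta>" using MCE_iff[OF am(1) bm(1)] by blast
    then obtain \<nu> where nu: "\<nu> \<in> paths \<Lambda>" "src \<Lambda> (\<alpha> \<cdot> \<mu>) = rng \<Lambda> \<nu>" "\<theta> = \<alpha> \<cdot> \<mu> \<cdot> \<nu>"
      by (rule initialE)
    have "\<nu> \<in> E" using nu th(1) am(3) by (simp add: E_def)
    moreover obtain \<kappa>' where k': "\<kappa>' \<in> paths \<Lambda>" "src \<Lambda> (\<alpha> \<cdot> \<mu>) = rng \<Lambda> \<kappa>'" "\<kappa> = \<alpha> \<cdot> \<mu> \<cdot> \<kappa>'"
      using amk(1) by (rule initialE)
    have "\<nu> \<preceq> \<kappa>'"
      using initial_comp_cancel[OF th(2)[unfolded nu(3) k'(3)] am(1) nu(2) k'(2) nu(1) k'(1)] .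
    moreover have "\<tau> \<preceq> \<kappa>'"
    proof (rule initial_comp_cancel[OF _ am(1) _ k'(2) t'(1) k'(1)])
      have "\<alpha> \<cdot> \<mu> \<cdot> \<tau> = \<alpha> \<cdot> (\<mu> \<cdot> \<tau>)"
        using comp_assoc[OF a mu(1) t'(1)] mu(3,4) t'(2) by simp
      then show "\<alpha> \<cdot> \<mu> \<cdot> \<tau> \<preceq> \<alpha> \<cdot> \<mu> \<cdot> \<kappa>'" using k(1) k'(3) by simp
    qed (use am t' in simp)
    ultimately show ?thesis using MCE_nonempty_iff[OF t'(1) nu(1)] by blast
  qed
  moreover have "E \<subseteq> at_vertex \<Lambda> (overt x N) (paths \<Lambda>)" by (auto simp: E_def at_vertex_def)
  ultimately have "E \<in> FE \<Lambda> (overt x N)" by (simp add: FE_def exhaustive_def)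
  then obtain p where p: "ext p \<le> odeg x - ext N" "oseg x N (N + p) \<in> E"
    using x(1) N unfolding boundary_paths_def by blast
  have Np: "ext (N + p) \<le> odeg x" using p(1) ext_le_diff_iff[OF N] by blast
  let ?\<nu> = "oseg x N (N + p)"
  have nu: "?\<nu> \<in> paths \<Lambda>" "deg \<Lambda> ?\<nu> = p" "rng \<Lambda> ?\<nu> = overt x N"
    using omegaD[OF xo fun_le_add Np] by simp_all
  have mce: "deg \<Lambda> (\<alpha> \<cdot> \<mu> \<cdot> ?\<nu>) = sup (deg \<Lambda> (\<alpha> \<cdot> \<mu>)) (deg \<Lambda> (\<beta> \<cdot> \<mu>))" "\<beta> \<cdot> \<mu> \<preceq> \<alpha> \<cdot> \<mu> \<cdot> ?\<nu>"
    using p(2) MCE_iff[OF am(1) bm(1)] by (auto simp only: E_def)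
  \<comment> \<open>Joins commute with translation by N, which is why the degree of the tail does
    not depend on N.\<close>
  have "deg \<Lambda> \<alpha> + N + p = sup (deg \<Lambda> \<alpha> + N) (deg \<Lambda> \<beta> + N)"
    using mce(1) deg_comp[OF am(1) nu(1)] am nu bm by simp
  also have "\<dots> = sup (deg \<Lambda> \<alpha>) (deg \<Lambda> \<beta>) + N"
    by (auto simp: fun_eq_iff sup_nat_def plus_fun_apply)
  finally have pm: "p = m" unfolding m by (simp add: fun_eq_iff plus_fun_apply)
  show "ext (N + m) \<le> odeg x" using Np pm by simp
  have "\<alpha> \<cdot> \<mu> \<cdot> ?\<nu> = \<alpha> \<cdot> oseg x 0 (N + m)"
    using comp_assoc[OF a mu(1) nu(1)] mu nu oseg_comp[OF xo zero_le_fun fun_le_add Np]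
    by (simp add: \<mu>_def pm)
  then show "\<beta> \<cdot> oseg x 0 N \<preceq> \<alpha> \<cdot> oseg x 0 (N + m)" using mce(2) by (simp add: \<mu>_def)
qed

end

section \<open>Boundary paths at the source of a periodic pair\<close>

lemma absorbs_imp_infinite:
  assumes "\<And>N. ext N \<le> M \<Longrightarrow> ext (N + m) \<le> M"
  shows "m i = 0 \<or> M i = \<infinity>"
proof (cases "M i")
  case (enat c)
  \<comment> \<open>Test degree: all of the finite value in coordinate i, nothing elsewhere. It can
    absorb m only if \<open>m i = 0\<close>.\<close>
  have "ext (\<lambda>j. if j = i then c else 0) \<le> M"
    using enat by (auto simp: le_fun_def zero_enat_def[symmetric])
  from le_funD[OF assms[OF this], of i] enat show ?thesis by (simp add: plus_fun_apply)
qed simp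

locale periodic_pair = k_graph \<Lambda> for \<Lambda> :: "('a, 'k::finite) kgraph" (structure) +
  fixes \<alpha> \<beta> :: 'a and m n :: "'k \<Rightarrow> nat"
  assumes fa: "finitely_aligned \<Lambda>"
    and a: "\<alpha> \<in> paths \<Lambda>" and b: "\<beta> \<in> paths \<Lambda>" and s: "src \<Lambda> \<alpha> = src \<Lambda> \<beta>"
    and periodic: "\<And>\<tau>. \<tau> \<in> paths \<Lambda> \<Longrightarrow> rng \<Lambda> \<tau> = src \<Lambda> \<alpha> \<Longrightarrow> \<exists>\<kappa>. \<alpha> \<cdot> \<tau> \<preceq> \<kappa> \<and> \<beta> \<cdot> \<tau> \<preceq> \<kappa>"
    and m: "sup (deg \<Lambda> \<alpha>) (deg \<Lambda> \<beta>) = deg \<Lambda> \<alpha> + m"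
    and n: "sup (deg \<Lambda> \<alpha>) (deg \<Lambda> \<beta>) = deg \<Lambda> \<beta> + n"
begin

context
  fixes x
  assumes x: "x \<in> boundary_paths \<Lambda>" and rx: "orng x = src \<Lambda> \<alpha>"
begin

lemma x_omega: "x \<in> omega_morphisms \<Lambda>"
  using x by (simp add: boundary_paths_def)

lemma absorb_left:
  assumes "ext N \<le> odeg x"
  shows "ext (N + m) \<le> odeg x" "\<beta> \<cdot> oseg x 0 N \<preceq> \<alpha> \<cdot> oseg x 0 (N + m)"
  using periodic_pair_boundary_path[OF fa a b s periodic x rx m assms] by blast+

lemma absorb_right:
  assumes "ext N \<le> odeg x"
  shows "ext (N + n) \<le> odeg x"
proof (rule periodic_pair_boundary_path(1)[OF fa b a s[symmetric] _ x _ _ assms])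
  show "sup (deg \<Lambda> \<beta>) (deg \<Lambda> \<alpha>) = deg \<Lambda> \<beta> + n" using n by (simp add: sup_commute)
  show "orng x = src \<Lambda> \<beta>" using rx s by simp
  show "\<exists>\<kappa>. \<beta> \<cdot> \<tau> \<preceq> \<kappa> \<and> \<alpha> \<cdot> \<tau> \<preceq> \<kappa>" if "\<tau> \<in> paths \<Lambda>" "rng \<Lambda> \<tau> = src \<Lambda> \<beta>" for \<tau>
    using periodic[of \<tau>] that s by auto
qed

text \<open>\<open>m i\<close> and \<open>n i\<close> both vanish exactly when \<alpha> and \<beta>
  have the same degree in direction i, so x is infinite wherever those degrees differ.\<close>

lemma infinite_direction: "(m i = 0 \<and> n i = 0) \<or> odeg x i = \<infinity>"
proof -
  have "m i = 0 \<or> odeg x i = \<infinity>" by (rule absorbs_imp_infinite) (rule absorb_left(1))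
  moreover have "n i = 0 \<or> odeg x i = \<infinity>" by (rule absorbs_imp_infinite) (rule absorb_right)
  ultimately show ?thesis by auto
qed

lemma periods_le: "ext m \<le> odeg x" "ext n \<le> odeg x"
  using absorb_left(1)[of 0, OF ext_zero_le] absorb_right[of 0, OF ext_zero_le] by simp_all

text \<open>Absorption at degree n + q makes \<beta>x(0,n+q) a prefix of \<alpha>x(0,n+q+m). So is
  \<alpha>x(0,m+q), and the degrees agree because d(\<alpha>) + m = d(\<beta>) + n.\<close>

lemma comp_oseg_eq:
  assumes q: "ext (n + q) \<le> odeg x" "ext (m + q) \<le> odeg x"
  shows "\<alpha> \<cdot> oseg x 0 (m + q) = \<beta> \<cdot> oseg x 0 (n + q)"
proof (rule initial_eq)
  have e: "n + q + m = m + q + n" by (simp add: add_ac)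
  have le: "ext (n + q + m) \<le> odeg x" "m + q \<le> n + q + m"
    using absorb_left(1)[OF q(1)] unfolding e by simp_all
  have r: "src \<Lambda> \<alpha> = rng \<Lambda> (oseg x 0 (m + q))" "src \<Lambda> \<beta> = rng \<Lambda> (oseg x 0 (n + q))"
    using omegaD(3)[OF x_omega zero_le_fun] q rx s by simp_all
  show "\<beta> \<cdot> oseg x 0 (n + q) \<preceq> \<alpha> \<cdot> oseg x 0 (n + q + m)" by (rule absorb_left(2)[OF q(1)])
  show "\<alpha> \<cdot> oseg x 0 (m + q) \<preceq> \<alpha> \<cdot> oseg x 0 (n + q + m)"
    by (rule initial_comp_left[OF oseg_initial[OF x_omega le(2,1)] a r(1)])
  have "deg \<Lambda> \<alpha> + (m + q) = deg \<Lambda> \<beta> + (n + q)" using m n by (metis add.assoc)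
  then show "deg \<Lambda> (\<alpha> \<cdot> oseg x 0 (m + q)) = deg \<Lambda> (\<beta> \<cdot> oseg x 0 (n + q))"
    using deg_comp[OF a omegaD(1)[OF x_omega zero_le_fun q(2)] r(1)]
      deg_comp[OF b omegaD(1)[OF x_omega zero_le_fun q(1)] r(2)]
      omegaD(2)[OF x_omega zero_le_fun q(1)] omegaD(2)[OF x_omega zero_le_fun q(2)] by simp
qed

lemma shift_eq: "shift m x = shift n x"
  unfolding shift_eq_iff[OF x_omega periods_le]
proof (intro conjI allI impI)
  show d: "odeg x - ext m = odeg x - ext n"
  proof
    fix i show "(odeg x - ext m) i = (odeg x - ext n) i"
      using infinite_direction[of i] by auto
  qed
  fix q assume q: "ext (m + q) \<le> odeg x"
  then have q': "ext (n + q) \<le> odeg x"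
    using d ext_le_diff_iff[OF periods_le(1)] ext_le_diff_iff[OF periods_le(2)] by metis
  have split: "\<gamma> \<cdot> oseg x 0 (l + q) = \<gamma> \<cdot> oseg x 0 l \<cdot> oseg x l (l + q)"
    "\<gamma> \<cdot> oseg x 0 l \<in> paths \<Lambda>" "src \<Lambda> (\<gamma> \<cdot> oseg x 0 l) = rng \<Lambda> (oseg x l (l + q))"
    "oseg x l (l + q) \<in> paths \<Lambda>"
    if "\<gamma> \<in> paths \<Lambda>" "src \<Lambda> \<gamma> = orng x" "ext (l + q) \<le> odeg x" "ext l \<le> odeg x" for \<gamma> l
  proof -
    note h = omegaD[OF x_omega zero_le_fun that(4)] and t = omegaD[OF x_omega fun_le_add that(3)]
    show "\<gamma> \<cdot> oseg x 0 l \<in> paths \<Lambda>" "src \<Lambda> (\<gamma> \<cdot> oseg x 0 l) = rng \<Lambda> (oseg x l (l + q))"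
      "oseg x l (l + q) \<in> paths \<Lambda>"
      using h t that(1,2) by (simp_all add: comp_closed src_comp)
    show "\<gamma> \<cdot> oseg x 0 (l + q) = \<gamma> \<cdot> oseg x 0 l \<cdot> oseg x l (l + q)"
      using comp_assoc[OF that(1) h(1) t(1)] h t that(2)
        oseg_comp[OF x_omega zero_le_fun fun_le_add that(3)] by simp
  qed
  note sa = split[OF a rx[symmetric] q periods_le(1)]
  note sb = split[OF b _ q' periods_le(2)]
  have rb: "src \<Lambda> \<beta> = orng x" using rx s by simp
  \<comment> \<open>The common head, namely the case q = 0; cancelling it from the case of general q
    leaves the segments of the two shifts.\<close>
  have eq0: "\<alpha> \<cdot> oseg x 0 m = \<beta> \<cdot> oseg x 0 n"
    using comp_oseg_eq[of 0] periods_le by simp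
  show "oseg x m (m + q) = oseg x n (n + q)"
  proof (rule comp_cancel_left[OF sa(2,4,3) sb(4)[OF rb]])
    show "src \<Lambda> (\<alpha> \<cdot> oseg x 0 m) = rng \<Lambda> (oseg x n (n + q))" using sb(3)[OF rb] eq0 by simp
    show "\<alpha> \<cdot> oseg x 0 m \<cdot> oseg x m (m + q) = \<alpha> \<cdot> oseg x 0 m \<cdot> oseg x n (n + q)"
      using comp_oseg_eq[OF q' q] sa(1) sb(1)[OF rb] eq0 by simp
  qed
qed

text \<open>Each \<beta>x(0,q) is a prefix of \<alpha>x(0,q+m), an initial segment of \<alpha>x. So
  \<alpha>x fits the description of \<beta>x.\<close>

lemma prepend_eq: "prepend \<Lambda> \<alpha> x = prepend \<Lambda> \<beta> x"
proof (rule prepend_eqI[symmetric])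
  show rb: "src \<Lambda> \<beta> = orng x" using rx s by simp
  note y = prepend_props[OF x_omega a rx[symmetric]]
  show "odeg (prepend \<Lambda> \<alpha> x) = odeg x + ext (deg \<Lambda> \<beta>)"
  proof
    fix i
    have "sup (deg \<Lambda> \<alpha> i) (deg \<Lambda> \<beta> i) = deg \<Lambda> \<alpha> i + m i"
      "sup (deg \<Lambda> \<alpha> i) (deg \<Lambda> \<beta> i) = deg \<Lambda> \<beta> i + n i"
      using fun_cong[OF m, of i] fun_cong[OF n, of i] by (simp_all add: plus_fun_apply)
    then have "deg \<Lambda> \<alpha> i = deg \<Lambda> \<beta> i \<or> odeg x i = \<infinity>" using infinite_direction[of i] by auto
    then show "odeg (prepend \<Lambda> \<alpha> x) i = (odeg x + ext (deg \<Lambda> \<beta>)) i"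
      unfolding y(2) by (auto simp: plus_fun_apply)
  qed
  fix q assume q: "ext q \<le> odeg x"
  let ?y = "prepend \<Lambda> \<alpha> x"
  have qm: "ext (q + m) \<le> odeg x" by (rule absorb_left(1)[OF q])
  have yle: "ext (deg \<Lambda> \<alpha> + (q + m)) \<le> odeg ?y"
    using qm unfolding y(2) by (simp add: le_fun_def plus_fun_apply add_left_mono add.commute[of "odeg x _"] flip: plus_enat_simps)
  have "\<beta> \<cdot> oseg x 0 q \<preceq> oseg ?y 0 (deg \<Lambda> \<alpha> + (q + m))"
    using absorb_left(2)[OF q] y(3)[OF qm] by simp
  from initial_oseg_eq[OF y(1) yle this]
  show "oseg ?y 0 (deg \<Lambda> \<beta> + q) = \<beta> \<cdot> oseg x 0 q"
    using deg_comp[OF b omegaD(1)[OF x_omega zero_le_fun q]] omegaD[OF x_omega zero_le_fun q] rb by simp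
qed (use x_omega b prepend_props[OF x_omega a rx[symmetric]] in auto)

end

end

section \<open>The implications between the conditions\<close>

context k_graph
begin

lemma not_aperiodic_obtains:
  assumes "finitely_aligned \<Lambda>" "\<not> aperiodic \<Lambda>"
  obtains \<alpha> \<beta> m n where "periodic_pair \<Lambda> \<alpha> \<beta> m n" "\<alpha> \<noteq> \<beta>"
proof -
  obtain \<alpha> \<beta> where ab: "\<alpha> \<in> paths \<Lambda>" "\<beta> \<in> paths \<Lambda>" "\<alpha> \<noteq> \<beta>" "src \<Lambda> \<alpha> = src \<Lambda> \<beta>"
    "\<And>\<tau>. \<tau> \<in> paths \<Lambda> \<Longrightarrow> rng \<Lambda> \<tau> = src \<Lambda> \<alpha> \<Longrightarrow> \<exists>\<kappa>. \<alpha> \<cdot> \<tau> \<preceq> \<kappa> \<and> \<beta> \<cdot> \<tau> \<preceq> \<kappa>"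
    using assms(2) unfolding aperiodic_iff by blast
  obtain m where m: "sup (deg \<Lambda> \<alpha>) (deg \<Lambda> \<beta>) = deg \<Lambda> \<alpha> + m"
    using le_fun_iff_ex_add[of "deg \<Lambda> \<alpha>" "sup (deg \<Lambda> \<alpha>) (deg \<Lambda> \<beta>)"] by auto
  obtain n where n: "sup (deg \<Lambda> \<alpha>) (deg \<Lambda> \<beta>) = deg \<Lambda> \<beta> + n"
    using le_fun_iff_ex_add[of "deg \<Lambda> \<beta>" "sup (deg \<Lambda> \<alpha>) (deg \<Lambda> \<beta>)"] by auto
  have "periodic_pair \<Lambda> \<alpha> \<beta> m n"
    by unfold_locales (use assms(1) ab m n in auto)
  with ab(3) show thesis by (rule that[rotated -1])
qed

lemma no_local_periodicity_imp_aperiodic: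
  assumes fa: "finitely_aligned \<Lambda>" and nlp: "no_local_periodicity \<Lambda>"
  shows "aperiodic \<Lambda>"
proof (rule ccontr)
  assume "\<not> aperiodic \<Lambda>"
  with fa obtain \<alpha> \<beta> m n where P: "periodic_pair \<Lambda> \<alpha> \<beta> m n" and ne: "\<alpha> \<noteq> \<beta>"
    by (rule not_aperiodic_obtains)
  interpret P: periodic_pair \<Lambda> \<alpha> \<beta> m n by (fact P)
  \<comment> \<open>Equal periods would mean equal degrees; but \<alpha> and \<beta> have a common
    extension (take \<tau> to be their source), and its prefix of a given degree is unique.\<close>
  have "m \<noteq> n"
  proof
    assume "m = n"
    then have d: "deg \<Lambda> \<alpha> = deg \<Lambda> \<beta>" using P.m P.n by (metis add_right_imp_eq)
    obtain \<kappa> where "\<alpha> \<preceq> \<kappa>" "\<beta> \<preceq> \<kappa>"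
      using P.periodic[of "src \<Lambda> \<alpha>"] P.a P.b P.s by (metis comp_src src_closed rng_src)
    then show False using initial_eq d ne by blast
  qed
  moreover have "local_periodicity \<Lambda> m n (src \<Lambda> \<alpha>)"
    unfolding local_periodicity_def
    using P.shift_eq P.periods_le ext_sup_le by blast
  ultimately show False
    using nlp src_in_verts[OF P.a] unfolding no_local_periodicity_def by blast
qed

lemma condition_B_imp_aperiodic:
  assumes fa: "finitely_aligned \<Lambda>" and B: "condition_B \<Lambda>"
  shows "aperiodic \<Lambda>"
proof (rule ccontr)
  assume "\<not> aperiodic \<Lambda>"
  with fa obtain \<alpha> \<beta> m n where P: "periodic_pair \<Lambda> \<alpha> \<beta> m n" and ne: "\<alpha> \<noteq> \<beta>"
    by (rule not_aperiodic_obtains)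
  interpret P: periodic_pair \<Lambda> \<alpha> \<beta> m n by (fact P)
  obtain x where "x \<in> le_infinity_paths \<Lambda>" "orng x = src \<Lambda> \<alpha>" "prepend \<Lambda> \<alpha> x \<noteq> prepend \<Lambda> \<beta> x"
    using B src_in_verts[OF P.a] P.a P.b P.s ne unfolding condition_B_def by metis
  then show False using P.prepend_eq le_infinity_subset_boundary by blast
qed

lemma condition_A_imp_no_local_periodicity:
  assumes "condition_A \<Lambda>"
  shows "no_local_periodicity \<Lambda>"
  unfolding no_local_periodicity_def
proof (intro ballI allI impI notI)
  fix v and m n :: "'k \<Rightarrow> nat"
  assume v: "v \<in> verts \<Lambda>" and ne: "m \<noteq> n" and lp: "local_periodicity \<Lambda> m n v"
  obtain x where x: "x \<in> boundary_paths \<Lambda>" "orng x = v"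
    "\<And>m n. ext m \<le> odeg x \<Longrightarrow> ext n \<le> odeg x \<Longrightarrow> shift m x = shift n x \<Longrightarrow> m = n"
    using assms v unfolding condition_A_def by blast
  have le: "ext (sup m n) \<le> odeg x" and eq: "shift m x = shift n x"
    using lp x(1,2) unfolding local_periodicity_def by blast+
  show False
    using x(3)[OF ext_mono_le[OF sup_ge1 le] ext_mono_le[OF sup_ge2 le] eq] ne by blast
qed

lemma aperiodic_imp_condition_B:
  assumes "aperiodic \<Lambda>"
  shows "condition_B \<Lambda>"
  unfolding condition_B_def
proof
  fix v assume v: "v \<in> verts \<Lambda>"
  define S where "S = {(\<alpha>, \<beta>). \<alpha> \<in> paths \<Lambda> \<and> \<beta> \<in> paths \<Lambda> \<and> src \<Lambda> \<alpha> = v \<and> src \<Lambda> \<beta> = v \<and> \<alpha> \<noteq> \<beta>}"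
  define P where "P = (\<lambda>(\<alpha>, \<beta>). {\<mu> \<in> paths \<Lambda>. rng \<Lambda> \<mu> = v \<and> \<not> (\<exists>\<kappa>. \<alpha> \<cdot> \<mu> \<preceq> \<kappa> \<and> \<beta> \<cdot> \<mu> \<preceq> \<kappa>)})"
  have "S \<subseteq> paths \<Lambda> \<times> paths \<Lambda>" by (auto simp: S_def)
  \<comment> \<open>Countability of \<Lambda> enters here.\<close>
  then have "countable (P ` S)" by (intro countable_image countable_subset[OF _ countable_SIGMA[OF countable_paths countable_paths]])
  moreover have "\<exists>\<kappa>\<in>Q. \<mu> \<preceq> \<kappa>" if Q: "Q \<in> P ` S" and m: "\<mu> \<in> paths \<Lambda>" "rng \<Lambda> \<mu> = v" for Q \<mu>
  proof -
    obtain \<alpha> \<beta> where ab: "\<alpha> \<in> paths \<Lambda>" "\<beta> \<in> paths \<Lambda>" "src \<Lambda> \<alpha> = v" "src \<Lambda> \<beta> = v" "\<alpha> \<noteq> \<beta>"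
      and QP: "Q = P (\<alpha>, \<beta>)" using Q by (auto simp: S_def)
    have am: "\<alpha> \<cdot> \<mu> \<in> paths \<Lambda>" "\<beta> \<cdot> \<mu> \<in> paths \<Lambda>" "src \<Lambda> (\<alpha> \<cdot> \<mu>) = src \<Lambda> \<mu>" "src \<Lambda> (\<beta> \<cdot> \<mu>) = src \<Lambda> \<mu>"
      using ab m by (simp_all add: comp_closed src_comp)
    \<comment> \<open>Density: aperiodicity is applied to \<alpha>\<mu> and \<beta>\<mu>, which
      right cancellation keeps distinct.\<close>
    have "\<alpha> \<cdot> \<mu> \<noteq> \<beta> \<cdot> \<mu>" using comp_cancel_right[of \<alpha> \<mu> \<beta>] ab m by auto
    then obtain \<tau> where t: "\<tau> \<in> paths \<Lambda>" "rng \<Lambda> \<tau> = src \<Lambda> \<mu>"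
      "\<not> (\<exists>\<kappa>. \<alpha> \<cdot> \<mu> \<cdot> \<tau> \<preceq> \<kappa> \<and> \<beta> \<cdot> \<mu> \<cdot> \<tau> \<preceq> \<kappa>)"
      using assms am unfolding aperiodic_iff by metis
    have "\<alpha> \<cdot> \<mu> \<cdot> \<tau> = \<alpha> \<cdot> (\<mu> \<cdot> \<tau>)" "\<beta> \<cdot> \<mu> \<cdot> \<tau> = \<beta> \<cdot> (\<mu> \<cdot> \<tau>)"
      using comp_assoc ab m t(1,2) by simp_all
    then have "\<mu> \<cdot> \<tau> \<in> Q"
      using t m by (simp add: QP P_def comp_closed rng_comp)
    moreover have "\<mu> \<preceq> \<mu> \<cdot> \<tau>" using m t by (simp add: initial_compI)
    ultimately show ?thesis by blast
  qed
  ultimately obtain x where x: "x \<in> le_infinity_paths \<Lambda>" "orng x = v"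
    "\<And>Q. Q \<in> P ` S \<Longrightarrow> \<exists>n. ext n \<le> odeg x \<and> oseg x 0 n \<in> Q"
    using generic_path[OF v, of "P ` S"] by blast
  have xo: "x \<in> omega_morphisms \<Lambda>" using x(1) by (simp add: le_infinity_paths_def)
  have "prepend \<Lambda> \<alpha> x \<noteq> prepend \<Lambda> \<beta> x" if ab: "(\<alpha>, \<beta>) \<in> S" for \<alpha> \<beta>
  proof
    assume eq: "prepend \<Lambda> \<alpha> x = prepend \<Lambda> \<beta> x"
    let ?y = "prepend \<Lambda> \<alpha> x"
    have *: "\<alpha> \<in> paths \<Lambda>" "\<beta> \<in> paths \<Lambda>" "src \<Lambda> \<alpha> = orng x" "src \<Lambda> \<beta> = orng x"
      using ab x(2) by (auto simp: S_def)
    obtain n where n: "ext n \<le> odeg x" "oseg x 0 n \<in> P (\<alpha>, \<beta>)" using x(3) ab by blast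
    note ya = prepend_props[OF xo *(1,3)] and yb = prepend_props[OF xo *(2,4), folded eq]
    have le: "ext (d + n) \<le> odeg ?y" if "odeg ?y = odeg x + ext d" for d
      using n(1) unfolding that
      by (simp add: le_fun_def plus_fun_apply add_left_mono add.commute[of "odeg x _"] flip: plus_enat_simps)
    \<comment> \<open>If \<alpha>x = \<beta>x, its initial segment of this degree extends both
      \<alpha>x(0,n) and \<beta>x(0,n), against the choice of n.\<close>
    let ?N = "sup (deg \<Lambda> \<alpha> + n) (deg \<Lambda> \<beta> + n)"
    have N: "ext ?N \<le> odeg ?y" by (rule ext_sup_le[OF le[OF ya(2)] le[OF yb(2)]])
    have "\<alpha> \<cdot> oseg x 0 n \<preceq> oseg ?y 0 ?N" "\<beta> \<cdot> oseg x 0 n \<preceq> oseg ?y 0 ?N"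
      using oseg_initial[OF ya(1) sup_ge1 N] oseg_initial[OF ya(1) sup_ge2 N]
      unfolding ya(3)[OF n(1)] yb(3)[OF n(1)] .
    then show False using n(2) by (auto simp: P_def)
  qed
  then show "\<exists>x\<in>le_infinity_paths \<Lambda>. orng x = v \<and>
    (\<forall>\<kappa>\<in>paths \<Lambda>. \<forall>\<mu>\<in>paths \<Lambda>. src \<Lambda> \<kappa> = v \<and> src \<Lambda> \<mu> = v \<and> \<kappa> \<noteq> \<mu> \<longrightarrow> prepend \<Lambda> \<kappa> x \<noteq> prepend \<Lambda> \<mu> x)"
    using x(1,2) unfolding S_def by blast
qed

lemma aperiodic_imp_condition_A:
  assumes "aperiodic \<Lambda>"
  shows "condition_A \<Lambda>"
  unfolding condition_A_def
proof
  fix v assume v: "v \<in> verts \<Lambda>"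
  define S where "S = {(m, n :: 'k \<Rightarrow> nat). m \<noteq> n}"
  \<comment> \<open>The second alternative removes initial segments of degrees m and n from \<mu>
    and asks that the two remainders be incompatible. The first covers segments that cannot grow to
    \<open>sup m n\<close>, for which no such removal is possible.\<close>
  define P where "P = (\<lambda>(m, n). {\<mu> \<in> paths \<Lambda>. (\<forall>\<kappa>. \<mu> \<preceq> \<kappa> \<longrightarrow> \<not> sup m n \<le> deg \<Lambda> \<kappa>) \<or>
    (\<exists>\<mu>\<^sub>m \<in> paths \<Lambda>. \<exists>\<mu>\<^sub>n \<in> paths \<Lambda>. \<exists>\<alpha> \<in> paths \<Lambda>. \<exists>\<beta> \<in> paths \<Lambda>.
      deg \<Lambda> \<mu>\<^sub>m = m \<and> src \<Lambda> \<mu>\<^sub>m = rng \<Lambda> \<alpha> \<and> \<mu> = \<mu>\<^sub>m \<cdot> \<alpha> \<and>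
      deg \<Lambda> \<mu>\<^sub>n = n \<and> src \<Lambda> \<mu>\<^sub>n = rng \<Lambda> \<beta> \<and> \<mu> = \<mu>\<^sub>n \<cdot> \<beta> \<and> \<not> (\<exists>\<kappa>. \<alpha> \<preceq> \<kappa> \<and> \<beta> \<preceq> \<kappa>))})"
  have "countable (P ` S)" by simp
  moreover have "\<exists>\<kappa>\<in>Q. \<mu> \<preceq> \<kappa>" if Q: "Q \<in> P ` S" and mu: "\<mu> \<in> paths \<Lambda>" "rng \<Lambda> \<mu> = v" for Q \<mu>
  proof -
    obtain m n where mn: "m \<noteq> n" and QP: "Q = P (m, n)" using Q by (auto simp: S_def)
    show ?thesis
    proof (cases "\<exists>\<kappa>. \<mu> \<preceq> \<kappa> \<and> sup m n \<le> deg \<Lambda> \<kappa>")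
      case False
      then have "\<mu> \<in> Q" using mu by (simp add: QP P_def)
      then show ?thesis using initial_refl mu by blast
    next
      case True
      then obtain \<kappa> where k: "\<mu> \<preceq> \<kappa>" "m \<le> deg \<Lambda> \<kappa>" "n \<le> deg \<Lambda> \<kappa>" by auto
      have kp: "\<kappa> \<in> paths \<Lambda>" using initialD(2)[OF k(1)] .
      obtain \<mu>\<^sub>m where "\<mu>\<^sub>m \<preceq> \<kappa>" and dm: "deg \<Lambda> \<mu>\<^sub>m = m" using kp k(2) by (rule initial_exists)
      then obtain \<alpha> where a: "\<mu>\<^sub>m \<in> paths \<Lambda>" "\<alpha> \<in> paths \<Lambda>" "src \<Lambda> \<mu>\<^sub>m = rng \<Lambda> \<alpha>" "\<kappa> = \<mu>\<^sub>m \<cdot> \<alpha>"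
        by (elim initialE)
      obtain \<mu>\<^sub>n where "\<mu>\<^sub>n \<preceq> \<kappa>" and dn: "deg \<Lambda> \<mu>\<^sub>n = n" using kp k(3) by (rule initial_exists)
      then obtain \<beta> where b: "\<mu>\<^sub>n \<in> paths \<Lambda>" "\<beta> \<in> paths \<Lambda>" "src \<Lambda> \<mu>\<^sub>n = rng \<Lambda> \<beta>" "\<kappa> = \<mu>\<^sub>n \<cdot> \<beta>"
        by (elim initialE)
      \<comment> \<open>Since m and n differ, the remainders have different degrees, so they form a
        distinct pair with common source, as aperiodicity requires.\<close>
      have "m + deg \<Lambda> \<alpha> = n + deg \<Lambda> \<beta>"
        using deg_comp[OF a(1-3)] deg_comp[OF b(1-3)] a(4) b(4) dm dn by simp
      then have "\<alpha> \<noteq> \<beta>" using mn by auto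
      moreover have s: "src \<Lambda> \<alpha> = src \<Lambda> \<kappa>" "src \<Lambda> \<beta> = src \<Lambda> \<kappa>"
        using src_comp[OF a(1-3)] src_comp[OF b(1-3)] a(4) b(4) by simp_all
      ultimately obtain \<tau> where t: "\<tau> \<in> paths \<Lambda>" "rng \<Lambda> \<tau> = src \<Lambda> \<kappa>"
        "\<not> (\<exists>\<theta>. \<alpha> \<cdot> \<tau> \<preceq> \<theta> \<and> \<beta> \<cdot> \<tau> \<preceq> \<theta>)"
        using assms a(2) b(2) unfolding aperiodic_iff by metis
      have eq: "\<kappa> \<cdot> \<tau> = \<mu>\<^sub>m \<cdot> (\<alpha> \<cdot> \<tau>)" "\<kappa> \<cdot> \<tau> = \<mu>\<^sub>n \<cdot> (\<beta> \<cdot> \<tau>)"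
        using comp_assoc[OF a(1,2) t(1) a(3)] comp_assoc[OF b(1,2) t(1) b(3)] s t(2) a(4) b(4) by simp_all
      have at: "\<alpha> \<cdot> \<tau> \<in> paths \<Lambda>" "\<beta> \<cdot> \<tau> \<in> paths \<Lambda>" "src \<Lambda> \<mu>\<^sub>m = rng \<Lambda> (\<alpha> \<cdot> \<tau>)" "src \<Lambda> \<mu>\<^sub>n = rng \<Lambda> (\<beta> \<cdot> \<tau>)"
        using a b t s by (simp_all add: comp_closed rng_comp)
      have kt: "\<kappa> \<preceq> \<kappa> \<cdot> \<tau>" using kp t by (simp add: initial_compI)
      have "\<kappa> \<cdot> \<tau> \<in> Q"
        unfolding QP P_def using initialD(2)[OF kt] a(1) b(1) dm dn at eq t(3) by blast
      moreover have "\<mu> \<preceq> \<kappa> \<cdot> \<tau>" using k(1) kt by (rule initial_trans)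
      ultimately show ?thesis by blast
    qed
  qed
  ultimately obtain x where x: "x \<in> le_infinity_paths \<Lambda>" "orng x = v"
    "\<And>Q. Q \<in> P ` S \<Longrightarrow> \<exists>n. ext n \<le> odeg x \<and> oseg x 0 n \<in> Q"
    using generic_path[OF v, of "P ` S"] by blast
  have xo: "x \<in> omega_morphisms \<Lambda>" using x(1) by (simp add: le_infinity_paths_def)
  have "m = n" if m: "ext m \<le> odeg x" and n: "ext n \<le> odeg x" and eq: "shift m x = shift n x" for m n
  proof (rule ccontr)
    assume "m \<noteq> n"
    then obtain N where N: "ext N \<le> odeg x" and NP: "oseg x 0 N \<in> P (m, n)"
      using x(3)[of "P (m, n)"] by (auto simp: S_def)
    \<comment> \<open>x itself extends its segment at N beyond \<open>sup m n\<close>, which rules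
      out the first alternative in P.\<close>
    let ?L = "sup N (sup m n)"
    have L: "ext ?L \<le> odeg x" using N m n ext_sup_le by blast
    have "oseg x 0 N \<preceq> oseg x 0 ?L" by (rule oseg_initial[OF xo sup_ge1 L])
    moreover have "sup m n \<le> deg \<Lambda> (oseg x 0 ?L)"
      using omegaD(2)[OF xo, of 0 ?L, OF zero_le_fun L] by (simp del: sup_apply)
    ultimately obtain \<mu>\<^sub>m \<mu>\<^sub>n \<alpha> \<beta> where a: "\<mu>\<^sub>m \<in> paths \<Lambda>" "\<alpha> \<in> paths \<Lambda>" "src \<Lambda> \<mu>\<^sub>m = rng \<Lambda> \<alpha>"
        "oseg x 0 N = \<mu>\<^sub>m \<cdot> \<alpha>" "deg \<Lambda> \<mu>\<^sub>m = m"
      and b: "\<mu>\<^sub>n \<in> paths \<Lambda>" "\<beta> \<in> paths \<Lambda>" "src \<Lambda> \<mu>\<^sub>n = rng \<Lambda> \<beta>" "oseg x 0 N = \<mu>\<^sub>n \<cdot> \<beta>" "deg \<Lambda> \<mu>\<^sub>n = n"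
      and no_ext: "\<not> (\<exists>\<kappa>. \<alpha> \<preceq> \<kappa> \<and> \<beta> \<preceq> \<kappa>)"
      using NP unfolding P_def by blast
    \<comment> \<open>The remainders are initial segments of the shifts by m and by n. If the shifts
      coincide, both remainders have a common extension.\<close>
    have shifted: "\<gamma> = oseg (shift l x) 0 (deg \<Lambda> \<gamma>) \<and> ext (deg \<Lambda> \<gamma>) \<le> odeg (shift l x)"
      if g: "\<mu>' \<in> paths \<Lambda>" "\<gamma> \<in> paths \<Lambda>" "src \<Lambda> \<mu>' = rng \<Lambda> \<gamma>" "oseg x 0 N = \<mu>' \<cdot> \<gamma>" "deg \<Lambda> \<mu>' = l"
        and l: "ext l \<le> odeg x" for \<mu>' \<gamma> l
    proof -
      have Nl: "N = l + deg \<Lambda> \<gamma>"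
        using omegaD(2)[OF xo zero_le_fun N] deg_comp[OF g(1-3)] g(4,5) by simp
      have lN: "l \<le> N" using Nl by simp
      have mu': "oseg x 0 l = \<mu>'"
        using initial_oseg_eq[OF xo N, of \<mu>'] initial_compI[OF g(1-3)] g(4,5) by simp
      have "\<mu>' \<cdot> \<gamma> = \<mu>' \<cdot> oseg x l N"
        using oseg_comp[OF xo zero_le_fun lN N] g(4) mu' by simp
      moreover have "src \<Lambda> \<mu>' = rng \<Lambda> (oseg x l N)"
        using omegaD(4)[OF xo zero_le_fun l] omegaD(3)[OF xo lN N] mu' by simp
      ultimately have "\<gamma> = oseg x l N"
        using comp_cancel_left[OF g(1-3) omegaD(1)[OF xo lN N]] by blast
      then have "\<gamma> = oseg (shift l x) 0 (deg \<Lambda> \<gamma>)"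
        using oseg_shift[of 0 "deg \<Lambda> \<gamma>" l x] N unfolding Nl by simp
      moreover have "ext (deg \<Lambda> \<gamma>) \<le> odeg (shift l x)"
        using ext_le_diff_iff[OF l] N unfolding Nl odeg_shift by blast
      ultimately show ?thesis by blast
    qed
    note A = shifted[OF a m] and B = shifted[OF b n, folded eq]
    let ?q = "sup (deg \<Lambda> \<alpha>) (deg \<Lambda> \<beta>)"
    have zo: "shift m x \<in> omega_morphisms \<Lambda>" by (rule shift_in_omega[OF xo m])
    have q: "ext ?q \<le> odeg (shift m x)" using A B ext_sup_le by blast
    have "\<alpha> \<preceq> oseg (shift m x) 0 ?q" "\<beta> \<preceq> oseg (shift m x) 0 ?q"
      using oseg_initial[OF zo sup_ge1 q] oseg_initial[OF zo sup_ge2 q] A B by metis+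
    with no_ext show False by blast
  qed
  then show "\<exists>x\<in>boundary_paths \<Lambda>. orng x = v \<and>
    (\<forall>m n. ext m \<le> odeg x \<and> ext n \<le> odeg x \<and> shift m x = shift n x \<longrightarrow> m = n)"
    using x(1,2) le_infinity_subset_boundary by blast
qed

end

theorem proposition3p6:
  fixes \<Lambda> :: "('a, 'k::finite) kgraph"
  assumes "k_graph \<Lambda>" and "finitely_aligned \<Lambda>"
  shows "(aperiodic \<Lambda> \<longleftrightarrow> no_local_periodicity \<Lambda>) \<and>
         (no_local_periodicity \<Lambda> \<longleftrightarrow> condition_A \<Lambda>) \<and>
         (condition_A \<Lambda> \<longleftrightarrow> condition_B \<Lambda>)"
proof -
  interpret k_graph \<Lambda> by (fact assms(1))
  \<comment> \<open>Aperiodicity gives (A), (A) excludes local periodicity, and its absence gives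
    aperiodicity back; (B) is linked to aperiodicity in both directions.\<close>
  show ?thesis
    using aperiodic_imp_condition_A aperiodic_imp_condition_B condition_A_imp_no_local_periodicity
      no_local_periodicity_imp_aperiodic[OF assms(2)] condition_B_imp_aperiodic[OF assms(2)]
    by blast
qed

end
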